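(* Let $d\ge1$. (a) Let $u_0(x)=e^{-\pi|x|^2}$ and $1\le r_1,r_2\le\infty$. Then $$\|e^{it\Delta}u_0\|_{W(L^{r_1},L^{r_2})}\sim C\,t^{d\left(\frac1{r_2}-\frac12\right)}\quad\text{as }t\to+\infty,$$ for some $C>0$, where $\sim$ means that the ratio of the two sides tends to $1$. (b) Suppose that for some $t_0\neq0$, $1\leq r_1,r_2\leq\infty$, $C>0$, the following estimate holds: $$\|e^{it_0\Delta}u_0\|_{W(L^{r_1},L^{r_2})}\leq C\|u_0\|_{W(L^{r_1'},L^{r_2'})}\quad\text{for all }u_0\in\mathcal S(\mathbb R^d).$$ Then $r_1\leq r_2$.
   Context: $p'$ denotes the conjugate exponent of $p$, and $1/\infty=0$. $e^{it\Delta}$ is the Schr\"odinger propagator on $\mathbb R^d$ (solution operator of $i\partial_tu+\Delta u=0$), i.e. the Fourier multiplier with symbol $e^{-4\pi^2it|\xi|^2}$, where $\hat f(\xi)=\int f(x)e^{-2\pi ix\xi}dx$. Wiener amalgam spaces: fix a window $g\in C_0^\infty(\mathbb R^d)$ with $\|g\|_{L^2}=1$ (a Gaussian window is also used in the paper) and let $T_yg(x)=g(x-y)$. $W(L^p,L^q)$ is the space of functions $f$ locally in $L^p$ with $\|f\|_{W(L^p,L^q)}=\big\|y\mapsto\|f\,T_yg\|_{L^p}\big\|_{L^q}<\infty$. Different windows give equivalent norms (so $C$ in (a) may depend on the window). *)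

theory Defs
  imports "HOL-Probability.Probability"
begin

text \<open>Lebesgue exponents range over the extended nonnegative reals, where \<open>1 / 0 = \<infinity>\<close> and
  \<open>1 / \<infinity> = 0\<close>.\<close>

definition conj_exponent :: "ennreal \<Rightarrow> ennreal"
  where "conj_exponent p = 1 / (1 - 1 / p)"

lemma conj_exponent_sum:
  assumes "1 \<le> p"
  shows "1 / p + 1 / conj_exponent p = 1"
proof -
  have le: "1 / p \<le> 1"
    using assms by (intro divide_le_posI_ennreal) (auto intro: less_le_trans[of 0 1])
  have "1 / (1 / (1 - 1 / p)) = 1 - 1 / p"
    by simp
  then show ?thesis
    using le by (simp add: conj_exponent_def add.commute diff_add_cancel_ennreal)
qed

lemma conj_exponent_1_top: "conj_exponent 1 = \<infinity>" "conj_exponent \<infinity> = 1"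
  by (simp_all add: conj_exponent_def divide_ennreal_def)

definition ennreal_powr :: "ennreal \<Rightarrow> real \<Rightarrow> ennreal"  (* intended for a > 0 *)
  where "ennreal_powr x a = (if x = \<infinity> then \<infinity> else ennreal (enn2real x powr a))"

text \<open>The norm is taken of an \<open>[0, \<infinity>]\<close>-valued function, so that it can be iterated.\<close>

definition Lp_norm :: "ennreal \<Rightarrow> ('a::euclidean_space \<Rightarrow> ennreal) \<Rightarrow> ennreal"
  where "Lp_norm p F =
    (if p = \<infinity> then esssup lborel F
     else ennreal_powr (\<integral>\<^sup>+ x. ennreal_powr (F x) (enn2real p) \<partial>lborel) (enn2real (1 / p)))"

definition amalgam_norm ::
  "('a::euclidean_space \<Rightarrow> complex) \<Rightarrow> ennreal \<Rightarrow> ennreal \<Rightarrow> ('a \<Rightarrow> complex) \<Rightarrow> ennreal"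
  where "amalgam_norm g p q f =
    Lp_norm q (\<lambda>y. Lp_norm p (\<lambda>x. ennreal (norm (f x * g (x - y)))))"

text \<open>\<open>iter_partial [b\<^sub>1, \<dots>, b\<^sub>k] f\<close> is the iterated partial derivative
  \<open>\<partial>\<^bsub>b\<^sub>1\<^esub> \<dots> \<partial>\<^bsub>b\<^sub>k\<^esub> f\<close>; it is meaningful for the smooth functions below.\<close>

fun iter_partial ::
  "'a::euclidean_space list \<Rightarrow> ('a \<Rightarrow> complex) \<Rightarrow> 'a \<Rightarrow> complex"
  where
    "iter_partial [] f = f"
  | "iter_partial (b # bs) f = (\<lambda>x. frechet_derivative (iter_partial bs f) (at x) b)"

definition smooth_fun :: "('a::euclidean_space \<Rightarrow> complex) \<Rightarrow> bool"
  where "smooth_fun f \<longleftrightarrow>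
    (\<forall>bs x. set bs \<subseteq> Basis \<longrightarrow> iter_partial bs f differentiable (at x))"

definition schwartz_fun :: "('a::euclidean_space \<Rightarrow> complex) \<Rightarrow> bool"
  where "schwartz_fun f \<longleftrightarrow> smooth_fun f \<and>
    (\<forall>bs k. set bs \<subseteq> Basis \<longrightarrow>
      (\<exists>B::real. \<forall>x. norm x ^ k * norm (iter_partial bs f x) \<le> B))"

definition test_fun :: "('a::euclidean_space \<Rightarrow> complex) \<Rightarrow> bool"
  where "test_fun f \<longleftrightarrow> smooth_fun f \<and> compact (closure {x. f x \<noteq> 0})"

definition gaussian :: "real \<Rightarrow> 'a::euclidean_space \<Rightarrow> complex"
  where "gaussian a x = complex_of_real (exp (- pi * a * (norm x)\<^sup>2))"

text \<open>Windows are normalised in \<open>L\<^sup>2\<close>; besides test functions, Gaussians are admitted.\<close>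

definition amalgam_window :: "('a::euclidean_space \<Rightarrow> complex) \<Rightarrow> bool"
  where "amalgam_window g \<longleftrightarrow>
    (test_fun g \<or> (\<exists>c a. a > 0 \<and> g = (\<lambda>x. c * gaussian a x))) \<and>
    Lp_norm 2 (\<lambda>x. ennreal (norm (g x))) = 1"

definition fourier :: "('a::euclidean_space \<Rightarrow> complex) \<Rightarrow> 'a \<Rightarrow> complex"
  where "fourier f \<xi> = (LINT x|lborel. f x * cis (- 2 * pi * (x \<bullet> \<xi>)))"

definition inverse_fourier :: "('a::euclidean_space \<Rightarrow> complex) \<Rightarrow> 'a \<Rightarrow> complex"
  where "inverse_fourier F x = (LINT \<xi>|lborel. F \<xi> * cis (2 * pi * (x \<bullet> \<xi>)))"

text \<open>The integral formula for the propagator suffices on Schwartz functions, where all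
  integrals converge absolutely.\<close>

definition schrodinger :: "real \<Rightarrow> ('a::euclidean_space \<Rightarrow> complex) \<Rightarrow> 'a \<Rightarrow> complex"
  where "schrodinger t f =
    inverse_fourier (\<lambda>\<xi>. cis (- 4 * pi\<^sup>2 * t * (norm \<xi>)\<^sup>2) * fourier f \<xi>)"

end

theory Submission
  imports Defs
begin

text \<open>
  Everything is tested on the Gaussians \<open>exp (- \<pi> a \<bar>x\<bar>\<^sup>2)\<close>. With \<open>D = 1 + (4 \<pi> a t)\<^sup>2\<close> the propagator
  turns such a function into one of modulus \<open>exp (- \<pi> (a / D) \<bar>x\<bar>\<^sup>2)\<close> times \<open>D\<close> to the power
  \<open>- d / 4\<close> (\<open>norm_schrodinger_gaussian\<close>). Amalgam norms only see moduli, so both claims are about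
  the size of amalgam norms of real Gaussians in two regimes.

  A wide Gaussian, \<open>s \<rightarrow> 0\<close>, is nearly constant on each translate of the window. The inner norm of
  \<open>W(L\<^sup>p, L\<^sup>q)\<close> then tends to the norm of the window, and the outer norm is that of the Gaussian itself,
  which scales like \<open>s\<close> to the power \<open>- d / (2 q)\<close>; hence the precise limit in
  \<open>amalgam_norm_wide_gaussian\<close>. A narrow Gaussian, \<open>a \<rightarrow> \<infinity>\<close>, is contained in one window; its norm
  scales like \<open>a\<close> to the power \<open>- d / (2 p)\<close>, and \<open>amalgam_norm_narrow_gaussian\<close> is the upper half
  of this.

  For the first claim \<open>a = 1\<close> and \<open>t \<rightarrow> \<infinity>\<close>: the solution is wide with \<open>s = 1 / D\<close>, and its peak
  and the scaling of the norm combine to the rate \<open>d (1 / q - 1 / 2)\<close>. For the second claim the time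
  is fixed and \<open>a \<rightarrow> \<infinity>\<close>: the datum is narrow while the solution is wide, with \<open>s\<close> of order
  \<open>1 / a\<close>. Comparing powers of \<open>a\<close>, the estimate forces \<open>1 / q \<le> 1 / p\<close>.
\<close>

section \<open>The modulus of a propagated Gaussian\<close>

text \<open>The characteristic function of the standard normal distribution, rescaled by
  \<open>x \<mapsto> \<surd>(2 \<pi> a) x\<close>.\<close>

lemma gaussian_fourier_real_line:
  fixes a \<xi> :: real
  assumes "a > 0"
  shows "integrable lborel (\<lambda>x::real. complex_of_real (exp (- pi * a * x\<^sup>2)) * cis (2 * pi * (x * \<xi>)))"
    and "(LINT x|lborel. complex_of_real (exp (- pi * a * x\<^sup>2)) * cis (2 * pi * (x * \<xi>)))
      = complex_of_real (a powr (- 1 / 2) * exp (- pi * \<xi>\<^sup>2 / a))"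
proof -
  define c where "c = sqrt (2 * pi * a)"
  have c: "c > 0" "c\<^sup>2 = 2 * pi * a" using assms by (auto simp: c_def)
  define t where "t = 2 * pi * \<xi> / c"
  let ?f = "\<lambda>x::real. std_normal_density x *\<^sub>R cis (t * x)"
  have int: "integrable lborel ?f"
  proof (rule Bochner_Integration.integrable_bound)
    show "integrable lborel std_normal_density" by simp
    show "AE x in lborel. norm (std_normal_density x *\<^sub>R cis (t * x)) \<le> norm (std_normal_density x)"
      by simp
  qed (simp add: cis_conv_exp)
  have "(LINT x|lborel. ?f x) = char std_normal_distribution t"
    unfolding char_def by (simp add: integral_density cis_conv_exp)
  then have char: "(LINT x|lborel. ?f x) = complex_of_real (exp (- (t\<^sup>2) / 2))"
    by (simp only: char_std_normal_distribution)
  have fc: "?f (0 + c * x) = complex_of_real (1 / sqrt (2 * pi))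
      * (complex_of_real (exp (- pi * a * x\<^sup>2)) * cis (2 * pi * (x * \<xi>)))" for x
  proof -
    have 1: "(c * x)\<^sup>2 / 2 = pi * a * x\<^sup>2" using c by (simp add: power_mult_distrib)
    have 2: "t * (c * x) = 2 * pi * (x * \<xi>)" using c by (simp add: t_def)
    show ?thesis
      unfolding add_0 2 by (simp add: normal_density_def scaleR_conv_of_real 1)
  qed
  have "integrable lborel (\<lambda>x. ?f (0 + c * x))"
    using int c(1) by (intro lborel_integrable_real_affine) auto
  then have "integrable lborel (\<lambda>x. complex_of_real (sqrt (2 * pi)) * ?f (0 + c * x))"
    by (rule integrable_mult_right)
  then show "integrable lborel (\<lambda>x::real. complex_of_real (exp (- pi * a * x\<^sup>2)) * cis (2 * pi * (x * \<xi>)))"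
    unfolding fc mult.assoc[symmetric] of_real_mult[symmetric] by simp
  have "(LINT x|lborel. ?f x) = \<bar>c\<bar> *\<^sub>R (LINT x|lborel. ?f (0 + c * x))"
    using c by (intro lborel_integral_real_affine) auto
  also have "\<dots> = complex_of_real (c / sqrt (2 * pi)) *
      (LINT x|lborel. complex_of_real (exp (- pi * a * x\<^sup>2)) * cis (2 * pi * (x * \<xi>)))"
    unfolding fc using c by (simp add: scaleR_conv_of_real)
  finally have eq: "complex_of_real (exp (- (t\<^sup>2) / 2)) = complex_of_real (sqrt a) *
      (LINT x|lborel. complex_of_real (exp (- pi * a * x\<^sup>2)) * cis (2 * pi * (x * \<xi>)))"
    unfolding char by (simp add: c_def real_sqrt_mult)
  have "t\<^sup>2 / 2 = pi * \<xi>\<^sup>2 / a"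
    using c assms by (simp add: t_def power_divide power_mult_distrib) (simp add: power2_eq_square)
  then have exp_t: "exp (- (t\<^sup>2) / 2) = exp (- pi * \<xi>\<^sup>2 / a)"
    by simp
  have sqrt_a: "a powr (- 1 / 2) = 1 / sqrt a"
    using assms by (simp add: powr_minus_divide powr_half_sqrt)
  show "(LINT x|lborel. complex_of_real (exp (- pi * a * x\<^sup>2)) * cis (2 * pi * (x * \<xi>)))
      = complex_of_real (a powr (- 1 / 2) * exp (- pi * \<xi>\<^sup>2 / a))"
    using assms unfolding sqrt_a of_real_mult eq[unfolded exp_t] mult.assoc[symmetric]
    by (simp flip: of_real_mult)
qed

lemma power2_norm_eq_sum_Basis:
  fixes x :: "'a::euclidean_space"
  shows "(norm x)\<^sup>2 = (\<Sum>b\<in>Basis. (x \<bullet> b)\<^sup>2)"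
  unfolding power2_norm_eq_inner by (subst euclidean_inner) (simp add: power2_eq_square)

text \<open>Both the Gaussian and the character factor over the coordinates, so the integral is a product of
  integrals over the line.\<close>

lemma gaussian_fourier:
  fixes \<xi> :: "'a::euclidean_space"
  assumes "a > 0"
  shows "integrable lborel (\<lambda>x. gaussian a x * cis (2 * pi * (x \<bullet> \<xi>)))"
    and "(LINT x|lborel. gaussian a x * cis (2 * pi * (x \<bullet> \<xi>)))
      = complex_of_real (a powr (- real DIM('a) / 2) * exp (- pi * (norm \<xi>)\<^sup>2 / a))"
proof -
  interpret product_sigma_finite "\<lambda>_::'a. lborel :: real measure" ..
  define f where "f b x = complex_of_real (exp (- pi * a * x\<^sup>2)) * cis (2 * pi * (x * (\<xi> \<bullet> b)))"
    for b :: 'a and x :: real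
  have prod: "gaussian a x * cis (2 * pi * (x \<bullet> \<xi>)) = (\<Prod>b\<in>Basis. f b (x \<bullet> b))" for x :: 'a
  proof -
    have n: "(norm x)\<^sup>2 = (\<Sum>b\<in>Basis. (x \<bullet> b)\<^sup>2)"
      by (rule power2_norm_eq_sum_Basis)
    have i: "x \<bullet> \<xi> = (\<Sum>b\<in>Basis. (x \<bullet> b) * (\<xi> \<bullet> b))"
      by (rule euclidean_inner)
    show ?thesis
      by (simp add: f_def prod.distrib gaussian_def n i sum_distrib_left exp_sum cis_conv_exp
          flip: exp_of_real)
  qed
  have meas: "(\<lambda>x. gaussian a x * cis (2 * pi * (x \<bullet> \<xi>))) \<in> borel_measurable borel"
    unfolding gaussian_def cis_conv_exp by measurable
  have [measurable]: "(\<lambda>f. \<Sum>b\<in>Basis. f b *\<^sub>R b) \<in> (\<Pi>\<^sub>M b\<in>(Basis::'a set). lborel) \<rightarrow>\<^sub>M borel"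
    by measurable
  have cong: "(\<lambda>x. gaussian a (\<Sum>b\<in>Basis. x b *\<^sub>R b) * cis (2 * pi * ((\<Sum>b\<in>Basis. x b *\<^sub>R b) \<bullet> \<xi>)))
     = (\<lambda>x. \<Prod>b\<in>Basis. f b (x b))"
    unfolding prod by (simp add: fun_eq_iff)
  have intf: "integrable lborel (f b)" for b
    unfolding f_def by (rule gaussian_fourier_real_line[OF assms])
  show "integrable lborel (\<lambda>x. gaussian a x * cis (2 * pi * (x \<bullet> \<xi>)))"
    by (subst lborel_eq, subst integrable_distr_eq)
       (use meas in \<open>simp_all add: cong product_integrable_prod intf\<close>)
  have "(LINT x|lborel. gaussian a x * cis (2 * pi * (x \<bullet> \<xi>))) = (\<Prod>b\<in>Basis. (LINT x|lborel. f b x))"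
    by (subst lborel_eq, subst integral_distr)
       (use meas in \<open>simp_all add: cong product_integral_prod intf\<close>)
  also have "\<dots> = (\<Prod>b\<in>(Basis::'a set). complex_of_real (a powr (- 1 / 2) * exp (- pi * (\<xi> \<bullet> b)\<^sup>2 / a)))"
    unfolding f_def by (simp only: gaussian_fourier_real_line[OF assms])
  also have "\<dots> = complex_of_real (a powr (- real DIM('a) / 2) * exp (- pi * (norm \<xi>)\<^sup>2 / a))"
  proof -
    have "(\<Prod>b\<in>(Basis::'a set). a powr (- 1 / 2)) = a powr (- real DIM('a) / 2)"
      using assms by (simp add: powr_powr flip: powr_realpow)
    moreover have "(\<Prod>b\<in>Basis. exp (- pi * (\<xi> \<bullet> b)\<^sup>2 / a)) = exp (- pi * (norm \<xi>)\<^sup>2 / a)"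
      by (subst exp_sum[symmetric])
         (simp_all add: power2_norm_eq_sum_Basis sum_distrib_left
           sum_divide_distrib sum_negf)
    ultimately show ?thesis
      unfolding of_real_prod[symmetric] prod.distrib by simp
  qed
  finally show "(LINT x|lborel. gaussian a x * cis (2 * pi * (x \<bullet> \<xi>)))
      = complex_of_real (a powr (- real DIM('a) / 2) * exp (- pi * (norm \<xi>)\<^sup>2 / a))" .
qed

lemma real_gaussian_integral:
  assumes "a > 0"
  shows "integrable lborel (\<lambda>x::'a::euclidean_space. exp (- pi * a * (norm x)\<^sup>2))"
    and "(LINT x::'a|lborel. exp (- pi * a * (norm x)\<^sup>2)) = a powr (- real DIM('a) / 2)"
proof -
  have eq: "(\<lambda>x::'a. gaussian a x * cis (2 * pi * (x \<bullet> 0)))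
      = (\<lambda>x. complex_of_real (exp (- pi * a * (norm x)\<^sup>2)))"
    by (simp add: gaussian_def fun_eq_iff)
  show "integrable lborel (\<lambda>x::'a. exp (- pi * a * (norm x)\<^sup>2))"
    using gaussian_fourier(1)[OF assms, of "0::'a"] unfolding eq complex_of_real_integrable_eq .
  have "complex_of_real (LINT x::'a|lborel. exp (- pi * a * (norm x)\<^sup>2))
      = complex_of_real (a powr (- real DIM('a) / 2))"
    using gaussian_fourier(2)[OF assms, of "0::'a"] unfolding eq integral_complex_of_real by simp
  then show "(LINT x::'a|lborel. exp (- pi * a * (norm x)\<^sup>2)) = a powr (- real DIM('a) / 2)"
    unfolding of_real_eq_iff .
qed

lemma lborel_integral_translate:
  fixes f :: "'a::euclidean_space \<Rightarrow> 'b::{banach, second_countable_topology}"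
  assumes "f \<in> borel_measurable borel"
  shows "(LINT x|lborel. f (c + x)) = (LINT x|lborel. f x)"
  by (subst (2) lborel_distr_plus[symmetric, of c], subst integral_distr) (use assms in auto)

lemma parallelogram_midpoint:
  fixes v w :: "'a::real_inner"
  shows "(norm (w + v /\<^sub>R 2))\<^sup>2 + (norm (w - v /\<^sub>R 2))\<^sup>2 = 2 * (norm w)\<^sup>2 + (norm v)\<^sup>2 / 2"
    and "(norm (w + v /\<^sub>R 2))\<^sup>2 - (norm (w - v /\<^sub>R 2))\<^sup>2 = 2 * (w \<bullet> v)"
  unfolding power2_norm_eq_inner
  by (simp_all add: inner_simps inner_commute)

text \<open>This is the Fourier transform of a Gaussian with complex parameter \<open>\<alpha> + i \<beta>\<close>, of which only the
  modulus matters here. Multiplying the integral by its conjugate gives a double integral over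
  \<open>\<xi>\<close> and \<open>\<eta>\<close>; in the coordinates \<open>v = \<xi> - \<eta>\<close> and \<open>w = (\<xi> + \<eta>) / 2\<close> the quadratic phase
  becomes the bilinear phase \<open>-2 \<pi> \<beta> (w \<bullet> v)\<close>. Hence the integrals over \<open>w\<close> and then over \<open>v\<close> are
  Fourier transforms of real Gaussians, and no complex square root has to be chosen.\<close>

lemma norm_chirped_gaussian_fourier:
  fixes x :: "'a::euclidean_space"
  assumes "\<alpha> > 0"
  shows "norm (LINT \<xi>|lborel. gaussian \<alpha> \<xi> * cis (- pi * \<beta> * (norm \<xi>)\<^sup>2) * cis (2 * pi * (\<xi> \<bullet> x)))
    = (\<alpha>\<^sup>2 + \<beta>\<^sup>2) powr (- real DIM('a) / 4) * exp (- pi * (\<alpha> / (\<alpha>\<^sup>2 + \<beta>\<^sup>2)) * (norm x)\<^sup>2)"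
proof -
  define h where "h \<xi> = gaussian \<alpha> \<xi> * cis (- pi * \<beta> * (norm \<xi>)\<^sup>2) * cis (2 * pi * (\<xi> \<bullet> x))"
    for \<xi> :: 'a
  define I where "I = (LINT \<xi>|lborel. h \<xi>)"
  define \<gamma> where "\<gamma> = (\<alpha>\<^sup>2 + \<beta>\<^sup>2) / (2 * \<alpha>)"
  have \<gamma>: "\<gamma> > 0" using assms by (simp add: \<gamma>_def add_pos_nonneg)
  have norm_h: "norm (h \<xi>) = exp (- pi * \<alpha> * (norm \<xi>)\<^sup>2)" for \<xi>
    by (simp add: h_def gaussian_def norm_mult)
  have cont_h: "continuous_on UNIV h"
    unfolding h_def gaussian_def cis_conv_exp by (intro continuous_intros)
  then have [measurable]: "h \<in> borel_measurable borel"
    by (rule borel_measurable_continuous_onI)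
  have [measurable]: "cnj \<in> borel_measurable borel"
    by (intro borel_measurable_continuous_onI continuous_intros)
  have int_h: "integrable lborel h"
    by (rule Bochner_Integration.integrable_bound[OF real_gaussian_integral(1)[OF assms]])
       (auto simp: norm_h)
  define P where "P = (\<lambda>(\<eta>, v). h (\<eta> + v) * cnj (h \<eta>))"
  define B where "B = (\<lambda>(\<eta>::'a, v::'a). exp (- pi * (\<alpha> / 2) * (norm \<eta>)\<^sup>2) * exp (- pi * (\<alpha> / 4) * (norm v)\<^sup>2))"
  \<comment> \<open>The modulus of \<open>P\<close> is not a product of functions of \<open>\<eta>\<close> and of \<open>v\<close>, but \<open>B\<close> is and dominates it.\<close>
  have "integrable (lborel \<Otimes>\<^sub>M lborel) B"
  proof (rule lborel_pair.Fubini_integrable)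
    show "B \<in> borel_measurable (lborel \<Otimes>\<^sub>M lborel)" unfolding B_def by measurable
    show "integrable lborel (\<lambda>\<eta>. LINT v|lborel. norm (B (\<eta>, v)))"
      unfolding B_def using assms by (simp add: real_gaussian_integral[of "\<alpha> / 2", simplified])
    show "AE \<eta> in lborel. integrable lborel (\<lambda>v. B (\<eta>, v))"
      unfolding B_def using assms by (simp add: real_gaussian_integral[of "\<alpha> / 4", simplified])
  qed
  then have int_P: "integrable (lborel \<Otimes>\<^sub>M lborel) P"
  proof (rule Bochner_Integration.integrable_bound)
    show "P \<in> borel_measurable (lborel \<Otimes>\<^sub>M lborel)" unfolding P_def by measurable
    show "AE p in lborel \<Otimes>\<^sub>M lborel. norm (P p) \<le> norm (B p)"
    proof (rule AE_I2)
      fix p :: "'a \<times> 'a"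
      obtain \<eta> v where p: "p = (\<eta>, v)" by fastforce
      \<comment> \<open>The shift \<open>2 / 3\<close> completes the square in \<open>\<eta>\<close> of \<open>3 / 2 \<bar>\<eta>\<bar>\<^sup>2 + 2 (\<eta> \<bullet> v) + 3 / 4 \<bar>v\<bar>\<^sup>2\<close>.\<close>
      have "0 \<le> (norm (\<eta> + (2 / 3) *\<^sub>R v))\<^sup>2" by simp
      also have "\<dots> = \<eta> \<bullet> \<eta> + 4 / 3 * (\<eta> \<bullet> v) + 4 / 9 * (v \<bullet> v)"
        unfolding power2_norm_eq_inner by (simp add: inner_simps inner_commute)
      finally have "v \<bullet> v / 4 + \<eta> \<bullet> \<eta> / 2 \<le> \<eta> \<bullet> \<eta> + 2 * (\<eta> \<bullet> v) + v \<bullet> v + \<eta> \<bullet> \<eta>"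
        using inner_ge_zero[of v] by linarith
      then have "(norm v)\<^sup>2 / 4 + (norm \<eta>)\<^sup>2 / 2 \<le> (norm (\<eta> + v))\<^sup>2 + (norm \<eta>)\<^sup>2"
        unfolding power2_norm_eq_inner by (simp add: inner_simps inner_commute)
      then have "pi * \<alpha> * ((norm v)\<^sup>2 / 4 + (norm \<eta>)\<^sup>2 / 2) \<le> pi * \<alpha> * ((norm (\<eta> + v))\<^sup>2 + (norm \<eta>)\<^sup>2)"
        using assms by (intro mult_left_mono) auto
      then show "norm (P p) \<le> norm (B p)"
        by (simp add: p P_def B_def norm_mult norm_h algebra_simps flip: exp_add)
    qed
  qed
  have "I * cnj I = (LINT \<eta>|lborel. I * cnj (h \<eta>))"
    using int_h unfolding I_def by simp
  also have "\<dots> = (LINT \<eta>|lborel. LINT v|lborel. h (\<eta> + v) * cnj (h \<eta>))"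
    unfolding I_def by (simp add: lborel_integral_translate[of h])
  also have "\<dots> = (LINT v|lborel. LINT \<eta>|lborel. h (\<eta> + v) * cnj (h \<eta>))"
    using lborel_pair.Fubini_integral[of "\<lambda>\<eta> v. h (\<eta> + v) * cnj (h \<eta>)"] int_P unfolding P_def by simp
  also have "\<dots> = (LINT v|lborel. LINT w|lborel. h (w + v /\<^sub>R 2) * cnj (h (w - v /\<^sub>R 2)))"
  proof (rule Bochner_Integration.integral_cong[OF refl])
    fix v :: 'a
    have half: "w - v /\<^sub>R 2 + v = w + v /\<^sub>R 2" "- (v /\<^sub>R 2) + w = w - v /\<^sub>R 2" for w
      by (simp_all add: algebra_simps flip: scaleR_add_left)
    show "(LINT \<eta>|lborel. h (\<eta> + v) * cnj (h \<eta>)) = (LINT w|lborel. h (w + v /\<^sub>R 2) * cnj (h (w - v /\<^sub>R 2)))"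
      using lborel_integral_translate[of "\<lambda>\<eta>. h (\<eta> + v) * cnj (h \<eta>)" "- (v /\<^sub>R 2)"]
      unfolding half by simp
  qed
  also have "\<dots> = (LINT v|lborel. LINT w|lborel. (exp (- pi * (\<alpha> / 2) * (norm v)\<^sup>2) * cis (2 * pi * (v \<bullet> x)))
      * (gaussian (2 * \<alpha>) w * cis (2 * pi * (w \<bullet> (- \<beta> *\<^sub>R v)))))"
  proof (intro Bochner_Integration.integral_cong refl)
    fix v w :: 'a
    let ?p = "norm (w + v /\<^sub>R 2)" and ?m = "norm (w - v /\<^sub>R 2)"
    have e: "exp (- pi * \<alpha> * (?p\<^sup>2 + ?m\<^sup>2)) = exp (- pi * \<alpha> * ?p\<^sup>2) * exp (- pi * \<alpha> * ?m\<^sup>2)"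
      by (simp add: algebra_simps flip: exp_add)
    have c: "cis (- pi * \<beta> * (?p\<^sup>2 - ?m\<^sup>2)) = cis (- pi * \<beta> * ?p\<^sup>2) * cnj (cis (- pi * \<beta> * ?m\<^sup>2))"
      unfolding cis_cnj cis_mult by (simp add: algebra_simps)
    have d: "cis (2 * pi * (v \<bullet> x))
        = cis (2 * pi * ((w + v /\<^sub>R 2) \<bullet> x)) * cnj (cis (2 * pi * ((w - v /\<^sub>R 2) \<bullet> x)))"
      unfolding cis_cnj cis_mult by (simp add: inner_simps algebra_simps)
    have "h (w + v /\<^sub>R 2) * cnj (h (w - v /\<^sub>R 2)) =
       complex_of_real (exp (- pi * \<alpha> * (?p\<^sup>2 + ?m\<^sup>2))) * cis (- pi * \<beta> * (?p\<^sup>2 - ?m\<^sup>2)) * cis (2 * pi * (v \<bullet> x))"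
      unfolding e c d h_def gaussian_def complex_cnj_mult complex_cnj_complex_of_real of_real_mult
      by (simp only: mult_ac)
    also have "\<dots> = (exp (- pi * (\<alpha> / 2) * (norm v)\<^sup>2) * cis (2 * pi * (v \<bullet> x)))
      * (gaussian (2 * \<alpha>) w * cis (2 * pi * (w \<bullet> (- \<beta> *\<^sub>R v))))"
      unfolding parallelogram_midpoint
      by (simp add: gaussian_def algebra_simps flip: exp_add of_real_mult)
    finally show "h (w + v /\<^sub>R 2) * cnj (h (w - v /\<^sub>R 2)) = (exp (- pi * (\<alpha> / 2) * (norm v)\<^sup>2) * cis (2 * pi * (v \<bullet> x)))
      * (gaussian (2 * \<alpha>) w * cis (2 * pi * (w \<bullet> (- \<beta> *\<^sub>R v))))" .
  qed
  also have "\<dots> = (LINT v|lborel. complex_of_real ((2 * \<alpha>) powr (- real DIM('a) / 2))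
      * (gaussian \<gamma> v * cis (2 * pi * (v \<bullet> x))))"
  proof (intro Bochner_Integration.integral_cong refl)
    fix v :: 'a
    have e: "- pi * (\<alpha> / 2) * (norm v)\<^sup>2 + - pi * (norm (- \<beta> *\<^sub>R v))\<^sup>2 / (2 * \<alpha>) = - pi * \<gamma> * (norm v)\<^sup>2"
      using assms by (simp add: \<gamma>_def power_mult_distrib field_simps power2_eq_square)
    have e': "exp (- pi * \<gamma> * (norm v)\<^sup>2)
        = exp (- pi * (\<alpha> / 2) * (norm v)\<^sup>2) * exp (- pi * (norm (- \<beta> *\<^sub>R v))\<^sup>2 / (2 * \<alpha>))"
      by (simp only: e[symmetric] exp_add)
    have "2 * \<alpha> > 0" using assms by simp
    then show "(LINT w|lborel. (exp (- pi * (\<alpha> / 2) * (norm v)\<^sup>2) * cis (2 * pi * (v \<bullet> x)))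
      * (gaussian (2 * \<alpha>) w * cis (2 * pi * (w \<bullet> (- \<beta> *\<^sub>R v)))))
      = complex_of_real ((2 * \<alpha>) powr (- real DIM('a) / 2)) * (gaussian \<gamma> v * cis (2 * pi * (v \<bullet> x)))"
      by (simp only: integral_mult_right_zero gaussian_fourier(2))
         (unfold gaussian_def e' of_real_mult, simp only: mult_ac)
  qed
  also have "\<dots> = complex_of_real ((2 * \<alpha>) powr (- real DIM('a) / 2)
       * (\<gamma> powr (- real DIM('a) / 2) * exp (- pi * (norm x)\<^sup>2 / \<gamma>)))"
    unfolding integral_mult_right_zero gaussian_fourier(2)[OF \<gamma>] by simp
  also have "(2 * \<alpha>) powr (- real DIM('a) / 2) * (\<gamma> powr (- real DIM('a) / 2) * exp (- pi * (norm x)\<^sup>2 / \<gamma>))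
      = ((\<alpha>\<^sup>2 + \<beta>\<^sup>2) powr (- real DIM('a) / 4) * exp (- pi * (\<alpha> / (\<alpha>\<^sup>2 + \<beta>\<^sup>2)) * (norm x)\<^sup>2))\<^sup>2"
  proof -
    have "2 * \<alpha> * \<gamma> = \<alpha>\<^sup>2 + \<beta>\<^sup>2" using assms by (simp add: \<gamma>_def)
    then have "(2 * \<alpha>) powr (- real DIM('a) / 2) * \<gamma> powr (- real DIM('a) / 2)
        = (\<alpha>\<^sup>2 + \<beta>\<^sup>2) powr (- real DIM('a) / 2)"
      using assms \<gamma> by (simp flip: powr_mult)
    moreover have "((\<alpha>\<^sup>2 + \<beta>\<^sup>2) powr (- real DIM('a) / 4))\<^sup>2 = (\<alpha>\<^sup>2 + \<beta>\<^sup>2) powr (- real DIM('a) / 2)"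
      by (simp add: power2_eq_square flip: powr_add)
    moreover have "(exp (- pi * (\<alpha> / (\<alpha>\<^sup>2 + \<beta>\<^sup>2)) * (norm x)\<^sup>2))\<^sup>2 = exp (- pi * (norm x)\<^sup>2 / \<gamma>)"
      by (simp add: \<gamma>_def flip: exp_double)
    ultimately show ?thesis by (simp add: power_mult_distrib)
  qed
  finally have "(norm I)\<^sup>2
      = ((\<alpha>\<^sup>2 + \<beta>\<^sup>2) powr (- real DIM('a) / 4) * exp (- pi * (\<alpha> / (\<alpha>\<^sup>2 + \<beta>\<^sup>2)) * (norm x)\<^sup>2))\<^sup>2"
    unfolding complex_norm_square[symmetric] of_real_eq_iff .
  then show ?thesis
    unfolding I_def h_def by (subst (asm) power2_eq_iff_nonneg) auto
qed

text \<open>The Fourier transform of the datum is a Gaussian with parameter \<open>1 / a\<close>, to which the propagator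
  adds the chirp with \<open>\<beta> = 4 \<pi> t\<close>. Evolution thus widens the Gaussian and lowers its peak.\<close>

lemma norm_schrodinger_gaussian:
  fixes x :: "'a::euclidean_space"
  assumes "a > 0"
  shows "norm (schrodinger t (gaussian a) x) =
    (1 + (4 * pi * a * t)\<^sup>2) powr (- real DIM('a) / 4)
      * exp (- pi * (a / (1 + (4 * pi * a * t)\<^sup>2)) * (norm x)\<^sup>2)"
proof -
  define A where "A = (1 / a)\<^sup>2 + (4 * pi * t)\<^sup>2"
  have F: "fourier (gaussian a) \<xi> = complex_of_real (a powr (- real DIM('a) / 2)) * gaussian (1 / a) \<xi>"
    for \<xi> :: 'a
    using gaussian_fourier(2)[OF assms, of "- \<xi>"] by (simp add: fourier_def gaussian_def)
  have "schrodinger t (gaussian a) x = (LINT \<xi>|lborel. complex_of_real (a powr (- real DIM('a) / 2)) *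
     (gaussian (1 / a) \<xi> * cis (- pi * (4 * pi * t) * (norm \<xi>)\<^sup>2) * cis (2 * pi * (\<xi> \<bullet> x))))"
    unfolding schrodinger_def inverse_fourier_def F
    by (intro Bochner_Integration.integral_cong) (simp_all add: mult_ac power2_eq_square inner_commute)
  then have "norm (schrodinger t (gaussian a) x) = a powr (- real DIM('a) / 2) *
      (A powr (- real DIM('a) / 4) * exp (- pi * ((1 / a) / A) * (norm x)\<^sup>2))"
    using assms norm_chirped_gaussian_fourier[of "1 / a" "4 * pi * t" x]
    by (simp add: norm_mult A_def)
  moreover have "a powr (- real DIM('a) / 2) * A powr (- real DIM('a) / 4)
      = (1 + (4 * pi * a * t)\<^sup>2) powr (- real DIM('a) / 4)"
  proof -
    have "a powr (- real DIM('a) / 2) = (a\<^sup>2) powr (- real DIM('a) / 4)"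
      using assms by (simp add: powr_powr flip: powr_numeral)
    moreover have "a\<^sup>2 * A = 1 + (4 * pi * a * t)\<^sup>2"
      using assms by (simp add: A_def field_simps)
    ultimately show ?thesis
      by (metis powr_mult zero_le_power2 A_def add_nonneg_nonneg)
  qed
  moreover have "(1 / a) / A = a / (1 + (4 * pi * a * t)\<^sup>2)"
  proof -
    have D: "1 + (4 * pi * a * t)\<^sup>2 = a * (a * A)"
      using assms by (simp add: A_def field_simps power2_eq_square)
    show ?thesis using assms unfolding D by (simp add: field_simps)
  qed
  ultimately show ?thesis by (simp only: mult.assoc[symmetric])
qed

section \<open>Lebesgue norms with extended real exponents\<close>

lemma ennreal_powr_ennreal: "0 \<le> x \<Longrightarrow> ennreal_powr (ennreal x) a = ennreal (x powr a)"
  by (simp add: ennreal_powr_def)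

lemma ennreal_powr_mono: "0 \<le> a \<Longrightarrow> x \<le> y \<Longrightarrow> ennreal_powr x a \<le> ennreal_powr y a"
  by (auto simp: ennreal_powr_def top_unique less_top intro!: ennreal_leI powr_mono2 enn2real_mono)

lemma ennreal_powr_cmult:
  assumes "c > 0"
  shows "ennreal_powr (ennreal c * x) a = ennreal (c powr a) * ennreal_powr x a"
proof (cases "x = \<infinity>")
  case True
  then show ?thesis using assms by (simp add: ennreal_powr_def ennreal_mult_top)
next
  case False
  then obtain r where "x = ennreal r" "r \<ge> 0" by (cases x) auto
  then show ?thesis
    using assms by (simp add: ennreal_powr_ennreal powr_mult flip: ennreal_mult)
qed

lemma ennreal_powr_eq_0_iff: "ennreal_powr x a = 0 \<longleftrightarrow> x = 0"
  by (auto simp: ennreal_powr_def enn2real_eq_0_iff)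

lemma borel_measurable_ennreal_powr [measurable]:
  assumes [measurable]: "F \<in> borel_measurable M"
  shows "(\<lambda>x. ennreal_powr (F x) a) \<in> borel_measurable M"
  unfolding ennreal_powr_def by measurable

lemma exponent_cases:
  fixes p :: ennreal
  assumes "1 \<le> p"
  obtains "p = \<infinity>" "enn2real (1 / p) = 0"
  | r where "r \<ge> 1" "p = ennreal r" "enn2real (1 / p) = 1 / r"
proof (cases "p = \<infinity>")
  case True
  then show ?thesis using that(1) by (simp add: divide_ennreal_def)
next
  case False
  then obtain r where r: "p = ennreal r" "r \<ge> 0" by (cases p) auto
  with assms have "r \<ge> 1" by simp
  moreover have "enn2real (1 / p) = 1 / r"
    using \<open>r \<ge> 1\<close> r by (simp add: divide_ennreal flip: ennreal_1)
  ultimately show ?thesis using that(2) r by blast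
qed

lemma Lp_norm_real:
  assumes "r \<ge> 1"
  shows "Lp_norm (ennreal r) F = ennreal_powr (\<integral>\<^sup>+ x. ennreal_powr (F x) r \<partial>lborel) (1 / r)"
proof -
  have "enn2real (1 / ennreal r) = 1 / r"
    using assms by (simp add: divide_ennreal flip: ennreal_1)
  then show ?thesis using assms by (simp add: Lp_norm_def)
qed

lemma Lp_norm_infinity: "Lp_norm \<infinity> F = esssup lborel F"
  by (simp add: Lp_norm_def)

lemma Lp_norm_mono:
  assumes "F \<in> borel_measurable borel" "\<And>x. F x \<le> G x"
  shows "Lp_norm p F \<le> Lp_norm p G"
  unfolding Lp_norm_def
  using assms by (auto intro!: esssup_mono ennreal_powr_mono nn_integral_mono)

lemma esssup_cmult_le:
  fixes F :: "'a::euclidean_space \<Rightarrow> ennreal"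
  assumes [measurable]: "F \<in> borel_measurable borel"
  shows "esssup lborel (\<lambda>x. c * F x) \<le> c * esssup lborel F"
proof (rule esssup_I)
  show "AE x in lborel. c * F x \<le> c * esssup lborel F"
    using esssup_AE[of F lborel] by eventually_elim (rule mult_left_mono, auto)
qed measurable

lemma Lp_norm_cmult:
  fixes F :: "'a::euclidean_space \<Rightarrow> ennreal"
  assumes p: "1 \<le> p" and c: "c > 0" and [measurable]: "F \<in> borel_measurable borel"
  shows "Lp_norm p (\<lambda>x. ennreal c * F x) = ennreal c * Lp_norm p F"
  using p
proof (cases rule: exponent_cases)
  case 1
  have inv: "ennreal (1 / c) * (ennreal c * x) = x" "ennreal c * (ennreal (1 / c) * x) = x" for x
    using c by (simp_all add: mult.assoc[symmetric] flip: ennreal_mult)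
  have "esssup lborel F = esssup lborel (\<lambda>x. ennreal (1 / c) * (ennreal c * F x))"
    by (simp add: inv)
  also have "\<dots> \<le> ennreal (1 / c) * esssup lborel (\<lambda>x. ennreal c * F x)"
    by (rule esssup_cmult_le) measurable
  finally have "ennreal c * esssup lborel F \<le> esssup lborel (\<lambda>x. ennreal c * F x)"
    by (metis inv(2) mult_left_mono zero_le)
  then show ?thesis
    using esssup_cmult_le[of F "ennreal c"] by (simp add: 1 Lp_norm_infinity[simplified] antisym)
next
  case (2 r)
  have "(c powr r) powr (1 / r) = c"
    using c 2 by (simp add: powr_powr)
  then show ?thesis
    using c 2 by (simp add: Lp_norm_real ennreal_powr_cmult nn_integral_cmult)
qed

lemma Lp_norm_eq_0_iff:
  fixes F :: "'a::euclidean_space \<Rightarrow> ennreal"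
  assumes p: "1 \<le> p" and [measurable]: "F \<in> borel_measurable borel"
  shows "Lp_norm p F = 0 \<longleftrightarrow> (AE x in lborel. F x = 0)"
  using p
proof (cases rule: exponent_cases)
  case 1
  show ?thesis
  proof
    assume "Lp_norm p F = 0"
    then have "esssup lborel F = 0" by (simp add: 1 Lp_norm_infinity[simplified])
    then show "AE x in lborel. F x = 0"
      using esssup_AE[of F lborel] by simp
  next
    assume "AE x in lborel. F x = 0"
    then have "esssup lborel F \<le> 0" by (intro esssup_I) auto
    then show "Lp_norm p F = 0" by (simp add: 1 Lp_norm_infinity[simplified])
  qed
next
  case (2 r)
  then show ?thesis
    by (simp add: Lp_norm_real ennreal_powr_eq_0_iff nn_integral_0_iff_AE)
qed

lemma Lp_norm_translate:
  fixes F :: "'a::euclidean_space \<Rightarrow> ennreal"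
  assumes p: "1 \<le> p" and [measurable]: "F \<in> borel_measurable borel"
  shows "Lp_norm p (\<lambda>x. F (x - y)) = Lp_norm p F"
  using p
proof (cases rule: exponent_cases)
  case 1
  have "(AE x in lborel. F x \<le> z) \<longleftrightarrow> (AE x in lborel. F (x - y) \<le> z)" for z
    by (subst lborel_distr_plus[symmetric, of "- y"], subst AE_distr_iff) auto
  then have "esssup lborel (\<lambda>x. F (x - y)) = esssup lborel F"
    by (simp add: esssup_eq_AE)
  then show ?thesis by (simp add: 1 Lp_norm_infinity[simplified])
next
  case (2 r)
  have "(\<integral>\<^sup>+ x. ennreal_powr (F x) r \<partial>lborel) = (\<integral>\<^sup>+ x. ennreal_powr (F (x - y)) r \<partial>lborel)"
    by (subst lborel_distr_plus[symmetric, of "- y"], subst nn_integral_distr) auto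
  then show ?thesis by (simp add: 2 Lp_norm_real)
qed

text \<open>A superlevel set of a continuous function is open, hence empty as soon as it is a null set.\<close>

lemma esssup_continuous:
  fixes h :: "'a::euclidean_space \<Rightarrow> real"
  assumes h: "continuous_on UNIV h"
  shows "esssup lborel (\<lambda>x. ennreal (h x)) = (SUP x. ennreal (h x))"
proof (rule antisym)
  have [measurable]: "h \<in> borel_measurable borel"
    by (rule borel_measurable_continuous_onI[OF h])
  show "esssup lborel (\<lambda>x. ennreal (h x)) \<le> (SUP x. ennreal (h x))"
    by (rule esssup_I) (auto intro!: AE_I2 SUP_upper)
  let ?U = "{x. esssup lborel (\<lambda>x. ennreal (h x)) < ennreal (h x)}"
  have "open ?U"
    by (intro open_Collect_less continuous_on_ennreal h continuous_intros)
  moreover have "emeasure lborel ?U = 0"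
    using esssup_zero_measure[of lborel "\<lambda>x. ennreal (h x)"] by simp
  ultimately have "negligible ?U"
    by (auto simp: negligible_iff_null_sets null_sets_def intro!: null_sets_completionI)
  then have "?U = {}"
    using \<open>open ?U\<close> open_not_negligible by blast
  then show "(SUP x. ennreal (h x)) \<le> esssup lborel (\<lambda>x. ennreal (h x))"
    by (intro SUP_least) (auto simp: not_less)
qed

text \<open>The constant \<open>\<kappa>\<close> is the norm for \<open>b = 1\<close>; the power of \<open>b\<close> is the effect of dilation. At
  \<open>p = \<infinity>\<close> the exponent vanishes.\<close>

lemma Lp_norm_gaussian:
  assumes p: "1 \<le> p"
  obtains \<kappa> where "\<kappa> > 0"
    "\<And>b. b > 0 \<Longrightarrow> Lp_norm p (\<lambda>x::'a::euclidean_space. ennreal (exp (- pi * b * (norm x)\<^sup>2)))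
      = ennreal (\<kappa> * b powr (- (real DIM('a) / 2 * enn2real (1 / p))))"
  using p
proof (cases rule: exponent_cases)
  case 1
  have "Lp_norm p (\<lambda>x::'a. ennreal (exp (- pi * b * (norm x)\<^sup>2))) = 1" if "b > 0" for b
  proof -
    have "Lp_norm p (\<lambda>x::'a. ennreal (exp (- pi * b * (norm x)\<^sup>2)))
        = (SUP x::'a. ennreal (exp (- pi * b * (norm x)\<^sup>2)))"
      unfolding 1 Lp_norm_infinity by (intro esssup_continuous continuous_intros)
    also have "\<dots> = 1"
    proof (rule antisym)
      show "(SUP x::'a. ennreal (exp (- pi * b * (norm x)\<^sup>2))) \<le> 1"
        using that by (intro SUP_least) auto
      show "1 \<le> (SUP x::'a. ennreal (exp (- pi * b * (norm x)\<^sup>2)))"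
        by (rule SUP_upper2[of 0]) auto
    qed
    finally show ?thesis .
  qed
  then show ?thesis using 1 by (intro that[of 1]) auto
next
  case (2 r)
  show ?thesis
  proof (rule that[of "(r powr (- real DIM('a) / 2)) powr (1 / r)"])
    show "(r powr (- real DIM('a) / 2)) powr (1 / r) > 0" using 2 by simp
    fix b :: real assume b: "b > 0"
    have "(\<integral>\<^sup>+ (x::'a). ennreal_powr (ennreal (exp (- pi * b * (norm x)\<^sup>2))) r \<partial>lborel)
        = (\<integral>\<^sup>+ (x::'a). ennreal (exp (- pi * (r * b) * (norm x)\<^sup>2)) \<partial>lborel)"
      by (simp add: ennreal_powr_ennreal exp_powr_real algebra_simps)
    also have "\<dots> = ennreal ((r * b) powr (- real DIM('a) / 2))"
      using 2 b by (subst nn_integral_eq_integral) (auto simp: real_gaussian_integral[of "r * b", simplified])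
    finally show "Lp_norm p (\<lambda>x::'a. ennreal (exp (- pi * b * (norm x)\<^sup>2))) =
       ennreal ((r powr (- real DIM('a) / 2)) powr (1 / r) * b powr (- (real DIM('a) / 2 * enn2real (1 / p))))"
      using 2 b by (simp add: Lp_norm_real ennreal_powr_ennreal powr_mult powr_powr)
  qed
qed

text \<open>The essential supremum of a non-measurable function is infinite by convention, so the outer norm of
  an amalgam norm can be bounded above only if the inner one is measurable. For finite \<open>p\<close> this is
  Fubini. For \<open>p = \<infinity>\<close> the inner norm is a supremum of continuous functions of \<open>y\<close>, hence lower
  semicontinuous.\<close>

lemma borel_measurable_Lp_norm_translates:
  fixes \<phi> \<psi> :: "'a::euclidean_space \<Rightarrow> real"
  assumes p: "1 \<le> p" and \<phi>: "continuous_on UNIV \<phi>" and \<psi>: "continuous_on UNIV \<psi>"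
  shows "(\<lambda>y. Lp_norm p (\<lambda>x. ennreal (\<phi> x * \<psi> (x - y)))) \<in> borel_measurable borel"
  using p
proof (cases rule: exponent_cases)
  case 1
  have \<psi>': "continuous_on UNIV (\<lambda>z. \<psi> (f z))" if "continuous_on UNIV f" for f :: "'a \<Rightarrow> 'a"
    using continuous_on_compose2[OF \<psi> that] by simp
  have eq: "Lp_norm p (\<lambda>x. ennreal (\<phi> x * \<psi> (x - y))) = (SUP x. ennreal (\<phi> x * \<psi> (x - y)))" for y
    unfolding 1 Lp_norm_infinity by (intro esssup_continuous continuous_intros \<phi> \<psi>')
  show ?thesis
  proof (rule borel_measurableI_greater)
    fix c :: ennreal
    have "{y. c < (SUP x. ennreal (\<phi> x * \<psi> (x - y)))} = (\<Union>x. {y. c < ennreal (\<phi> x * \<psi> (x - y))})"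
      by (auto simp: less_SUP_iff)
    also have "open \<dots>"
      by (intro open_UN ballI open_Collect_less continuous_on_ennreal continuous_intros \<psi>')
    finally show "{y \<in> space borel. c < Lp_norm p (\<lambda>x. ennreal (\<phi> x * \<psi> (x - y)))} \<in> sets borel"
      unfolding eq by simp
  qed
next
  case (2 r)
  have [measurable]: "\<phi> \<in> borel_measurable borel" "\<psi> \<in> borel_measurable borel"
    by (auto intro: borel_measurable_continuous_onI \<phi> \<psi>)
  show ?thesis
    unfolding 2 Lp_norm_real[OF 2(1)] by measurable
qed

section \<open>Windows and their weighted norms\<close>

lemma continuous_gaussian: "continuous_on UNIV (gaussian a)"
  unfolding gaussian_def by (intro continuous_intros)

lemma norm_gaussian: "norm (gaussian a x) = exp (- pi * a * (norm x)\<^sup>2)"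
  by (simp add: gaussian_def)

lemma continuous_test_fun:
  assumes "test_fun g"
  shows "continuous_on UNIV g"
proof -
  have "iter_partial [] g differentiable (at x)" for x
    using assms unfolding test_fun_def smooth_fun_def by (metis empty_subsetI list.set(1))
  then show ?thesis
    by (auto intro!: continuous_at_imp_continuous_on differentiable_imp_continuous_within)
qed

lemma continuous_amalgam_window:
  assumes "amalgam_window g"
  shows "continuous_on UNIV g"
  using assms unfolding amalgam_window_def
  by (auto intro: continuous_test_fun intro!: continuous_intros continuous_gaussian)

lemma test_fun_bounded_support:
  assumes "test_fun g"
  obtains R where "R > 0" "\<And>x. g x \<noteq> 0 \<Longrightarrow> norm x \<le> R"
proof -
  have "bounded {x. g x \<noteq> 0}"
    using assms unfolding test_fun_def
    by (meson bounded_subset closure_subset compact_imp_bounded)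
  then show ?thesis using that unfolding bounded_pos by auto
qed

text \<open>Gaussian decay is what the two kinds of window have in common.\<close>

lemma amalgam_window_gaussian_bound:
  fixes g :: "'a::euclidean_space \<Rightarrow> complex"
  assumes "amalgam_window g"
  obtains M \<epsilon> where "M > 0" "\<epsilon> > 0" "\<And>x. norm (g x) \<le> M * exp (- pi * \<epsilon> * (norm x)\<^sup>2)"
proof -
  consider "test_fun g" | c a where "a > 0" "g = (\<lambda>x. c * gaussian a x)"
    using assms unfolding amalgam_window_def by blast
  then show ?thesis
  proof cases
    case 1
    obtain R where R: "R > 0" "\<And>x. g x \<noteq> 0 \<Longrightarrow> norm x \<le> R"
      using test_fun_bounded_support[OF 1] by blast
    have "compact (g ` cball 0 R)"
      by (intro compact_continuous_image compact_cball continuous_on_subset[OF continuous_test_fun[OF 1]]) auto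
    then obtain B where B: "B > 0" "\<And>x. norm x \<le> R \<Longrightarrow> norm (g x) \<le> B"
      by (metis bounded_pos compact_imp_bounded imageI mem_cball_0)
    show ?thesis
    proof (rule that[of "B * exp (pi * R\<^sup>2)" 1])
      fix x :: 'a
      show "norm (g x) \<le> B * exp (pi * R\<^sup>2) * exp (- pi * 1 * (norm x)\<^sup>2)"
      proof (cases "g x = 0")
        case False
        then have x: "norm x \<le> R" by (rule R)
        then have "(norm x)\<^sup>2 \<le> R\<^sup>2" by (simp add: power_mono)
        then have "1 \<le> exp (pi * R\<^sup>2 - pi * (norm x)\<^sup>2)" by simp
        then have "B * 1 \<le> B * exp (pi * R\<^sup>2 - pi * (norm x)\<^sup>2)"
          using B(1) by (intro mult_left_mono) auto
        then show ?thesis using B(2)[OF x] by (simp add: exp_diff exp_minus divide_inverse)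
      qed (use B in simp)
    qed (use B in auto)
  next
    case 2
    show ?thesis
    proof (rule that[of "norm c + 1" a])
      fix x
      show "norm (g x) \<le> (norm c + 1) * exp (- pi * a * (norm x)\<^sup>2)"
        unfolding 2 norm_mult norm_gaussian by (intro mult_right_mono) auto
    qed (use 2 in \<open>auto intro: add_nonneg_pos\<close>)
  qed
qed

text \<open>The weight is close to 1 for small \<open>\<tau>\<close>, which may have either sign: these norms absorb the error
  made by replacing a wide Gaussian, on the support of a translated window, by its value at the
  centre of that window.\<close>

definition weighted_window_norm ::
  "('a::euclidean_space \<Rightarrow> complex) \<Rightarrow> ennreal \<Rightarrow> real \<Rightarrow> ennreal"
  where "weighted_window_norm g p \<tau> =
    Lp_norm p (\<lambda>z. ennreal (exp (- pi * \<tau> * (norm z)\<^sup>2) * norm (g z)))"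

lemma weighted_window_norm_0_pos_finite:
  fixes g :: "'a::euclidean_space \<Rightarrow> complex"
  assumes g: "amalgam_window g" and p: "1 \<le> p"
  shows "weighted_window_norm g p 0 \<noteq> 0" "weighted_window_norm g p 0 < \<infinity>"
proof -
  have [measurable]: "g \<in> borel_measurable borel"
    by (rule borel_measurable_continuous_onI[OF continuous_amalgam_window[OF g]])
  show "weighted_window_norm g p 0 \<noteq> 0"
  proof
    assume "weighted_window_norm g p 0 = 0"
    then have "AE x in lborel. ennreal (norm (g x)) = 0"
      unfolding weighted_window_norm_def using p by (subst (asm) Lp_norm_eq_0_iff) auto
    then have "Lp_norm 2 (\<lambda>x. ennreal (norm (g x))) = 0"
      by (subst Lp_norm_eq_0_iff) auto
    then show False using g by (simp add: amalgam_window_def)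
  qed
  obtain M \<epsilon> where M: "M > 0" "\<epsilon> > 0" "\<And>x. norm (g x) \<le> M * exp (- pi * \<epsilon> * (norm x)\<^sup>2)"
    using amalgam_window_gaussian_bound[OF g] by blast
  obtain \<kappa> where \<kappa>: "\<kappa> > 0"
    "\<And>b. b > 0 \<Longrightarrow> Lp_norm p (\<lambda>x::'a. ennreal (exp (- pi * b * (norm x)\<^sup>2)))
      = ennreal (\<kappa> * b powr (- (real DIM('a) / 2 * enn2real (1 / p))))"
    using Lp_norm_gaussian[OF p] by blast
  have "weighted_window_norm g p 0
      \<le> Lp_norm p (\<lambda>x::'a. ennreal M * ennreal (exp (- pi * \<epsilon> * (norm x)\<^sup>2)))"
    unfolding weighted_window_norm_def
  proof (rule Lp_norm_mono)
    show "ennreal (exp (- pi * 0 * (norm x)\<^sup>2) * norm (g x)) \<le> ennreal M * ennreal (exp (- pi * \<epsilon> * (norm x)\<^sup>2))" for x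
      using M by (simp flip: ennreal_mult)
  qed measurable
  also have "\<dots> = ennreal M * Lp_norm p (\<lambda>x::'a. ennreal (exp (- pi * \<epsilon> * (norm x)\<^sup>2)))"
    using M by (intro Lp_norm_cmult p) auto
  also have "\<dots> < \<infinity>"
    using M unfolding \<kappa>(2)[OF M(2)] by (simp add: ennreal_mult_less_top)
  finally show "weighted_window_norm g p 0 < \<infinity>" .
qed

text \<open>On a bounded support the weight lies between \<open>exp (- \<pi> \<bar>\<tau>\<bar> R\<^sup>2)\<close> and \<open>exp (\<pi> \<bar>\<tau>\<bar> R\<^sup>2)\<close>. For a
  Gaussian window the weight only shifts the parameter, so the norm is known exactly.\<close>

lemma weighted_window_norm_near_0:
  fixes g :: "'a::euclidean_space \<Rightarrow> complex"
  assumes g: "amalgam_window g" and p: "1 \<le> p"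
  obtains w \<delta> where "\<delta> > 0" "w 0 > 0" "isCont w 0"
    "\<And>\<tau>. \<bar>\<tau>\<bar> < \<delta> \<Longrightarrow> w \<tau> > 0 \<and> weighted_window_norm g p \<tau> = ennreal (w \<tau>)"
proof -
  note W0 = weighted_window_norm_0_pos_finite[OF g p]
  have [measurable]: "g \<in> borel_measurable borel"
    by (rule borel_measurable_continuous_onI[OF continuous_amalgam_window[OF g]])
  consider "test_fun g" | c a where "a > 0" "g = (\<lambda>x. c * gaussian a x)"
    using g unfolding amalgam_window_def by blast
  then show ?thesis
  proof cases
    case 1
    obtain R where R: "R > 0" "\<And>x. g x \<noteq> 0 \<Longrightarrow> norm x \<le> R"
      using test_fun_bounded_support[OF 1] by blast
    obtain v where v: "v > 0" "weighted_window_norm g p 0 = ennreal v"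
      using W0 by (cases "weighted_window_norm g p 0") (auto simp: less_le)
    have v0: "Lp_norm p (\<lambda>z. ennreal (norm (g z))) = ennreal v"
      using v(2) by (simp add: weighted_window_norm_def)
    have weight: "\<bar>pi * \<tau> * (norm x)\<^sup>2\<bar> \<le> pi * \<bar>\<tau>\<bar> * R\<^sup>2" if "g x \<noteq> 0" for \<tau> x
      using R(2)[OF that] by (simp add: abs_mult mult_left_mono power_mono)
    have lo: "ennreal (exp (- pi * \<bar>\<tau>\<bar> * R\<^sup>2) * v) \<le> weighted_window_norm g p \<tau>" for \<tau>
    proof -
      have "ennreal (exp (- pi * \<bar>\<tau>\<bar> * R\<^sup>2) * v)
          = Lp_norm p (\<lambda>z. ennreal (exp (- pi * \<bar>\<tau>\<bar> * R\<^sup>2)) * ennreal (norm (g z)))"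
        using p v by (simp add: Lp_norm_cmult v0 ennreal_mult)
      also have "\<dots> \<le> weighted_window_norm g p \<tau>"
        unfolding weighted_window_norm_def
      proof (rule Lp_norm_mono)
        fix z
        have "exp (- pi * \<bar>\<tau>\<bar> * R\<^sup>2) * norm (g z) \<le> exp (- pi * \<tau> * (norm z)\<^sup>2) * norm (g z)"
          using weight[of z \<tau>] by (cases "g z = 0") (auto simp: abs_le_iff)
        then show "ennreal (exp (- pi * \<bar>\<tau>\<bar> * R\<^sup>2)) * ennreal (norm (g z))
            \<le> ennreal (exp (- pi * \<tau> * (norm z)\<^sup>2) * norm (g z))"
          by (simp flip: ennreal_mult)
      qed measurable
      finally show ?thesis .
    qed
    have hi: "weighted_window_norm g p \<tau> \<le> ennreal (exp (pi * \<bar>\<tau>\<bar> * R\<^sup>2) * v)" for \<tau>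
    proof -
      have "weighted_window_norm g p \<tau>
          \<le> Lp_norm p (\<lambda>z. ennreal (exp (pi * \<bar>\<tau>\<bar> * R\<^sup>2)) * ennreal (norm (g z)))"
        unfolding weighted_window_norm_def
      proof (rule Lp_norm_mono)
        fix z
        have "exp (- pi * \<tau> * (norm z)\<^sup>2) * norm (g z) \<le> exp (pi * \<bar>\<tau>\<bar> * R\<^sup>2) * norm (g z)"
          using weight[of z \<tau>] by (cases "g z = 0") (auto simp: abs_le_iff)
        then show "ennreal (exp (- pi * \<tau> * (norm z)\<^sup>2) * norm (g z))
            \<le> ennreal (exp (pi * \<bar>\<tau>\<bar> * R\<^sup>2)) * ennreal (norm (g z))"
          by (simp flip: ennreal_mult)
      qed measurable
      also have "\<dots> = ennreal (exp (pi * \<bar>\<tau>\<bar> * R\<^sup>2) * v)"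
        using p v by (simp add: Lp_norm_cmult v0 ennreal_mult)
      finally show ?thesis .
    qed
    define w where "w \<tau> = enn2real (weighted_window_norm g p \<tau>)" for \<tau>
    have W: "weighted_window_norm g p \<tau> = ennreal (w \<tau>)" for \<tau>
      using hi[of \<tau>] unfolding w_def by (metis ennreal_enn2real ennreal_less_top le_less_trans)
    have w0: "w \<tau> \<ge> 0" for \<tau> by (simp add: w_def)
    have lo': "exp (- pi * \<bar>\<tau>\<bar> * R\<^sup>2) * v \<le> w \<tau>" for \<tau>
      using lo[of \<tau>] w0[of \<tau>] unfolding W by simp
    have hi': "w \<tau> \<le> exp (pi * \<bar>\<tau>\<bar> * R\<^sup>2) * v" for \<tau>
      using hi[of \<tau>] v(1) unfolding W by simp
    have pos: "w \<tau> > 0" for \<tau>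
      using lo'[of \<tau>] v(1) by (smt (verit) exp_gt_zero mult_pos_pos)
    have "w 0 = v"
      using lo'[of 0] hi'[of 0] by simp
    moreover have "(w \<longlongrightarrow> v) (at 0)"
    proof (rule tendsto_sandwich)
      show "((\<lambda>\<tau>. exp (- pi * \<bar>\<tau>\<bar> * R\<^sup>2) * v) \<longlongrightarrow> v) (at 0)"
        by (auto intro!: tendsto_eq_intros)
      show "((\<lambda>\<tau>. exp (pi * \<bar>\<tau>\<bar> * R\<^sup>2) * v) \<longlongrightarrow> v) (at 0)"
        by (auto intro!: tendsto_eq_intros)
    qed (use lo' hi' in auto)
    ultimately have "isCont w 0" by (simp add: isCont_def)
    then show ?thesis using pos W by (intro that[of 1 w]) auto
  next
    case 2
    have "c \<noteq> 0"
    proof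
      assume "c = 0"
      then have "weighted_window_norm g p 0 = 0"
        using p by (simp add: weighted_window_norm_def 2 Lp_norm_eq_0_iff)
      then show False using W0 by simp
    qed
    obtain \<kappa> where \<kappa>: "\<kappa> > 0"
      "\<And>b. b > 0 \<Longrightarrow> Lp_norm p (\<lambda>x::'a. ennreal (exp (- pi * b * (norm x)\<^sup>2)))
        = ennreal (\<kappa> * b powr (- (real DIM('a) / 2 * enn2real (1 / p))))"
      using Lp_norm_gaussian[OF p] by blast
    define w where "w \<tau> = norm c * (\<kappa> * (a + \<tau>) powr (- (real DIM('a) / 2 * enn2real (1 / p))))" for \<tau>
    have W: "weighted_window_norm g p \<tau> = ennreal (w \<tau>)" if "\<bar>\<tau>\<bar> < a" for \<tau>
    proof -
      have pos: "a + \<tau> > 0" using that by auto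
      have "weighted_window_norm g p \<tau>
          = Lp_norm p (\<lambda>z::'a. ennreal (norm c) * ennreal (exp (- pi * (a + \<tau>) * (norm z)\<^sup>2)))"
        unfolding weighted_window_norm_def 2 norm_mult norm_gaussian
        by (simp add: mult.left_commute algebra_simps flip: ennreal_mult exp_add)
      also have "\<dots> = ennreal (norm c) * Lp_norm p (\<lambda>z::'a. ennreal (exp (- pi * (a + \<tau>) * (norm z)\<^sup>2)))"
        using \<open>c \<noteq> 0\<close> p by (intro Lp_norm_cmult) auto
      also have "\<dots> = ennreal (w \<tau>)"
        unfolding \<kappa>(2)[OF pos] w_def by (simp add: ennreal_mult')
      finally show ?thesis .
    qed
    have "isCont w 0"
      unfolding w_def using 2(1) by (intro continuous_intros) auto
    then show ?thesis
      using W 2(1) \<kappa>(1) \<open>c \<noteq> 0\<close> by (intro that[of a w]) (auto simp: w_def)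
  qed
qed

text \<open>The right-hand side has the sign of \<open>\<eta>\<close>. The sum of separate squares therefore bounds
  \<open>\<bar>z + y\<bar>\<^sup>2\<close> from above when \<open>\<eta> > 0\<close> and from below when \<open>\<eta> < 0\<close>.\<close>

lemma weighted_square_expansion:
  fixes y z :: "'a::real_inner"
  assumes "\<eta> \<noteq> 0"
  shows "(1 + \<eta>) * (norm y)\<^sup>2 + (1 + 1 / \<eta>) * (norm z)\<^sup>2 - (norm (z + y))\<^sup>2
    = (norm (\<eta> *\<^sub>R y - z))\<^sup>2 / \<eta>"
  using assms unfolding power2_norm_eq_inner
  by (simp add: inner_simps inner_commute field_simps)

text \<open>Write \<open>x = z + y\<close> and replace \<open>\<bar>z + y\<bar>\<^sup>2\<close> by the separate squares of \<open>weighted_square_expansion\<close>.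
  The integrand then is a function of \<open>y\<close> times a function of \<open>z\<close>, and the iterated norm is the
  product of a weighted norm of the window and the norm of a Gaussian.\<close>

lemma amalgam_norm_gaussian_bounds:
  fixes g :: "'a::euclidean_space \<Rightarrow> complex"
  assumes p: "1 \<le> p" and q: "1 \<le> q" and g: "continuous_on UNIV g" and s: "s > 0"
    and w: "w > 0" "weighted_window_norm g p (s * (1 + 1 / \<eta>)) = ennreal w"
  shows "\<eta> > 0 \<Longrightarrow> ennreal w * Lp_norm q (\<lambda>y::'a. ennreal (exp (- pi * (s * (1 + \<eta>)) * (norm y)\<^sup>2)))
           \<le> amalgam_norm g p q (gaussian s)"
    and "\<eta> < 0 \<Longrightarrow> amalgam_norm g p q (gaussian s)
           \<le> ennreal w * Lp_norm q (\<lambda>y::'a. ennreal (exp (- pi * (s * (1 + \<eta>)) * (norm y)\<^sup>2)))"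
proof -
  have gm [measurable]: "g \<in> borel_measurable borel"
    by (rule borel_measurable_continuous_onI[OF g])
  define H where "H z = exp (- pi * (s * (1 + 1 / \<eta>)) * (norm z)\<^sup>2) * norm (g z)" for z
  define E where "E y = exp (- pi * (s * (1 + \<eta>)) * (norm y)\<^sup>2)" for y :: 'a
  define N where "N y = Lp_norm p (\<lambda>x. ennreal (norm (gaussian s x * g (x - y))))" for y
  have H [measurable]: "H \<in> borel_measurable borel" unfolding H_def by measurable
  have E [measurable]: "E \<in> borel_measurable borel" unfolding E_def by measurable
  have Epos: "E y > 0" for y by (simp add: E_def)
  have N [measurable]: "N \<in> borel_measurable borel"
    unfolding N_def norm_mult
    by (intro borel_measurable_Lp_norm_translates p continuous_intros continuous_gaussian g)
  have split: "Lp_norm p (\<lambda>x. ennreal (E y * H (x - y))) = ennreal w * ennreal (E y)" for y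
  proof -
    have "Lp_norm p (\<lambda>x. ennreal (E y * H (x - y))) = ennreal (E y) * Lp_norm p (\<lambda>x. ennreal (H (x - y)))"
      using p Epos[of y] by (simp add: ennreal_mult' Lp_norm_cmult)
    also have "Lp_norm p (\<lambda>x. ennreal (H (x - y))) = ennreal w"
      using p w(2) Lp_norm_translate[of p "\<lambda>z. ennreal (H z)" y]
      by (simp add: H_def weighted_window_norm_def)
    finally show ?thesis by (simp add: mult.commute)
  qed
  have EH: "E y * H (x - y) = exp (- pi * s * ((1 + \<eta>) * (norm y)\<^sup>2 + (1 + 1 / \<eta>) * (norm (x - y))\<^sup>2)) * norm (g (x - y))"
    for x y
    unfolding E_def H_def by (simp add: algebra_simps flip: exp_add)
  have Ng: "norm (gaussian s x * g (x - y)) = exp (- pi * s * (norm (x - y + y))\<^sup>2) * norm (g (x - y))" for x y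
    by (simp add: norm_mult norm_gaussian)
  have outer: "Lp_norm q (\<lambda>y. ennreal w * ennreal (E y)) = ennreal w * Lp_norm q (\<lambda>y. ennreal (E y))"
    using q w by (intro Lp_norm_cmult) auto
  have am: "amalgam_norm g p q (gaussian s) = Lp_norm q N"
    by (simp add: amalgam_norm_def N_def[abs_def])
  {
    assume \<eta>: "\<eta> > 0"
    have "ennreal w * ennreal (E y) \<le> N y" for y
      unfolding split[symmetric] N_def
    proof (rule Lp_norm_mono)
      fix x
      have "0 \<le> (norm (\<eta> *\<^sub>R y - (x - y)))\<^sup>2 / \<eta>" using \<eta> by simp
      then have "(norm (x - y + y))\<^sup>2 \<le> (1 + \<eta>) * (norm y)\<^sup>2 + (1 + 1 / \<eta>) * (norm (x - y))\<^sup>2"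
        using weighted_square_expansion[of \<eta> y "x - y"] \<eta> by linarith
      then show "ennreal (E y * H (x - y)) \<le> ennreal (norm (gaussian s x * g (x - y)))"
        unfolding EH Ng using s by (intro ennreal_leI mult_right_mono) auto
    qed measurable
    then have "Lp_norm q (\<lambda>y. ennreal w * ennreal (E y)) \<le> Lp_norm q N"
      by (intro Lp_norm_mono) measurable
    then show "ennreal w * Lp_norm q (\<lambda>y::'a. ennreal (exp (- pi * (s * (1 + \<eta>)) * (norm y)\<^sup>2)))
           \<le> amalgam_norm g p q (gaussian s)"
      unfolding outer am unfolding E_def .
  next
    assume \<eta>: "\<eta> < 0"
    have "N y \<le> ennreal w * ennreal (E y)" for y
      unfolding split[symmetric] N_def
    proof (rule Lp_norm_mono)
      fix x
      have "(norm (\<eta> *\<^sub>R y - (x - y)))\<^sup>2 / \<eta> \<le> 0" using \<eta> by (simp add: divide_nonneg_neg)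
      then have "(1 + \<eta>) * (norm y)\<^sup>2 + (1 + 1 / \<eta>) * (norm (x - y))\<^sup>2 \<le> (norm (x - y + y))\<^sup>2"
        using weighted_square_expansion[of \<eta> y "x - y"] \<eta> by linarith
      then show "ennreal (norm (gaussian s x * g (x - y))) \<le> ennreal (E y * H (x - y))"
        unfolding EH Ng using s by (intro ennreal_leI mult_right_mono) auto
    next
      show "(\<lambda>x. ennreal (norm (gaussian s x * g (x - y)))) \<in> borel_measurable borel"
        unfolding gaussian_def by measurable
    qed
    then have "Lp_norm q N \<le> Lp_norm q (\<lambda>y. ennreal w * ennreal (E y))"
      by (intro Lp_norm_mono) measurable
    then show "amalgam_norm g p q (gaussian s)
           \<le> ennreal w * Lp_norm q (\<lambda>y::'a. ennreal (exp (- pi * (s * (1 + \<eta>)) * (norm y)\<^sup>2)))"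
      unfolding outer am unfolding E_def .
  }
qed

text \<open>A window sees a very wide Gaussian as locally constant, so that its amalgam norm is asymptotically
  the product of the inner norm of the window and the outer norm of the Gaussian. Quantitatively, take
  \<open>\<eta> = \<plusminus>\<surd>s\<close> in the two bounds: this makes both \<open>1 + \<eta> \<rightarrow> 1\<close> and the weight parameter
  \<open>s (1 + 1 / \<eta>) = s \<plusminus> \<surd>s \<rightarrow> 0\<close>.\<close>

lemma amalgam_norm_wide_gaussian:
  fixes g :: "'a::euclidean_space \<Rightarrow> complex"
  assumes g: "amalgam_window g" and p: "1 \<le> p" and q: "1 \<le> q"
  obtains L where "L > 0"
    "((\<lambda>s. amalgam_norm g p q (gaussian s) * ennreal (s powr (real DIM('a) / 2 * enn2real (1 / q))))
        \<longlongrightarrow> ennreal L) (at_right 0)"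
proof -
  define e where "e = real DIM('a) / 2 * enn2real (1 / q)"
  obtain w \<delta> where w: "\<delta> > 0" "w 0 > 0" "isCont w 0"
    "\<And>\<tau>. \<bar>\<tau>\<bar> < \<delta> \<Longrightarrow> w \<tau> > 0 \<and> weighted_window_norm g p \<tau> = ennreal (w \<tau>)"
    using weighted_window_norm_near_0[OF g p] by metis
  obtain \<kappa> where \<kappa>: "\<kappa> > 0"
    "\<And>b. b > 0 \<Longrightarrow> Lp_norm q (\<lambda>x::'a. ennreal (exp (- pi * b * (norm x)\<^sup>2))) = ennreal (\<kappa> * b powr (- e))"
    using Lp_norm_gaussian[OF q] unfolding e_def by metis
  note cont = continuous_amalgam_window[OF g]
  define lo where "lo s = w (s + sqrt s) * (\<kappa> * (1 + sqrt s) powr (- e))" for s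
  define up where "up s = w (s - sqrt s) * (\<kappa> * (1 - sqrt s) powr (- e))" for s
  have t0: "((\<lambda>s. s + sqrt s) \<longlongrightarrow> 0) (at_right 0)" "((\<lambda>s. s - sqrt s) \<longlongrightarrow> 0) (at_right 0)"
    "((\<lambda>s. sqrt s) \<longlongrightarrow> 0) (at_right 0)"
    by (auto intro!: tendsto_eq_intros)
  have lim_lo: "(lo \<longlongrightarrow> w 0 * \<kappa>) (at_right 0)"
    unfolding lo_def using t0 w(3)
    by (auto intro!: tendsto_eq_intros isCont_tendsto_compose[OF w(3)])
  have lim_up: "(up \<longlongrightarrow> w 0 * \<kappa>) (at_right 0)"
    unfolding up_def using t0 w(3)
    by (auto intro!: tendsto_eq_intros isCont_tendsto_compose[OF w(3)])
  have "eventually (\<lambda>s. \<bar>s + sqrt s\<bar> < \<delta>) (at_right 0)" "eventually (\<lambda>s. \<bar>s - sqrt s\<bar> < \<delta>) (at_right 0)"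
    using t0(1,2) w(1) unfolding tendsto_iff dist_real_def by auto
  moreover have "eventually (\<lambda>s::real. 0 < s \<and> s < 1) (at_right 0)"
    by (rule eventually_mono[OF eventually_at_right_real[of 0 1]]) auto
  ultimately have ev: "eventually (\<lambda>s. ennreal (lo s) \<le> amalgam_norm g p q (gaussian s) * ennreal (s powr e)
      \<and> amalgam_norm g p q (gaussian s) * ennreal (s powr e) \<le> ennreal (up s)) (at_right 0)"
  proof eventually_elim
    case (elim s)
    \<comment> \<open>Here \<open>r\<close> and \<open>- r\<close> are the values of \<open>\<eta>\<close> in the lower and in the upper bound.\<close>
    define r where "r = sqrt s"
    have r: "r > 0" "r < 1" "s = r * r" using elim by (simp_all add: r_def)
    have scale: "(s * (1 + \<eta>)) powr (- e) * s powr e = (1 + \<eta>) powr (- e)" if "1 + \<eta> > 0" for \<eta>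
      using elim that by (simp add: powr_mult powr_minus)
    have W: "s * (1 + 1 / r) = s + r" "s * (1 + 1 / (- r)) = s - r"
      using r by (simp_all add: field_simps)
    have small: "\<bar>s + r\<bar> < \<delta>" "\<bar>s - r\<bar> < \<delta>"
      using elim by (simp_all add: r_def)
    have 1: "w (s + r) > 0" "weighted_window_norm g p (s * (1 + 1 / r)) = ennreal (w (s + r))"
      using w(4)[OF small(1)] unfolding W by auto
    have 2: "w (s - r) > 0" "weighted_window_norm g p (s * (1 + 1 / (- r))) = ennreal (w (s - r))"
      using w(4)[OF small(2)] unfolding W by auto
    have "ennreal (lo s) = ennreal (w (s + r)) * ennreal (\<kappa> * (s * (1 + r)) powr (- e)) * ennreal (s powr e)"
      using scale[of r] 1 r \<kappa>(1) by (simp add: lo_def mult.assoc flip: r_def ennreal_mult)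
    also have "\<dots> \<le> amalgam_norm g p q (gaussian s) * ennreal (s powr e)"
      using amalgam_norm_gaussian_bounds(1)[OF p q cont _ 1] \<kappa>(2)[of "s * (1 + r)"] r
      by (intro mult_right_mono) auto
    finally have lower: "ennreal (lo s) \<le> amalgam_norm g p q (gaussian s) * ennreal (s powr e)" .
    have "amalgam_norm g p q (gaussian s) * ennreal (s powr e)
        \<le> ennreal (w (s - r)) * ennreal (\<kappa> * (s * (1 - r)) powr (- e)) * ennreal (s powr e)"
      using amalgam_norm_gaussian_bounds(2)[OF p q cont _ 2] \<kappa>(2)[of "s * (1 - r)"] r
      by (intro mult_right_mono) auto
    also have "\<dots> = ennreal (up s)"
      using scale[of "- r"] 2 r \<kappa>(1) by (simp add: up_def mult.assoc flip: r_def ennreal_mult)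
    finally show ?case using lower by blast
  qed
  have "((\<lambda>s. amalgam_norm g p q (gaussian s) * ennreal (s powr e)) \<longlongrightarrow> ennreal (w 0 * \<kappa>)) (at_right 0)"
    by (rule tendsto_sandwich[where f = "\<lambda>s. ennreal (lo s)" and h = "\<lambda>s. ennreal (up s)"])
       (use ev in \<open>auto intro!: tendsto_ennrealI lim_lo lim_up elim: eventually_mono\<close>)
  then show ?thesis
    using w(2) \<kappa>(1) unfolding e_def by (intro that[of "w 0 * \<kappa>"]) auto
qed

text \<open>A narrow Gaussian is concentrated inside a single window, so that only the inner exponent governs
  its size. Half of its decay is kept for the inner norm; a fixed part of the other half, together
  with the decay of the window, yields a Gaussian in \<open>y\<close> of fixed width.\<close>

lemma amalgam_norm_narrow_gaussian:
  fixes g :: "'a::euclidean_space \<Rightarrow> complex"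
  assumes g: "amalgam_window g" and p: "1 \<le> p" and q: "1 \<le> q"
  obtains D where "D > 0"
    "\<And>a. a \<ge> 1 \<Longrightarrow> amalgam_norm g p q (gaussian a)
       \<le> ennreal (D * a powr (- (real DIM('a) / 2 * enn2real (1 / p))))"
proof -
  obtain M \<epsilon> where M: "M > 0" "\<epsilon> > 0" "\<And>x. norm (g x) \<le> M * exp (- pi * \<epsilon> * (norm x)\<^sup>2)"
    using amalgam_window_gaussian_bound[OF g] by blast
  define e where "e p = real DIM('a) / 2 * enn2real (1 / p)" for p
  obtain \<kappa> where \<kappa>: "\<kappa> > 0"
    "\<And>b. b > 0 \<Longrightarrow> Lp_norm p (\<lambda>x::'a. ennreal (exp (- pi * b * (norm x)\<^sup>2))) = ennreal (\<kappa> * b powr (- e p))"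
    using Lp_norm_gaussian[OF p] unfolding e_def by metis
  obtain \<mu> where \<mu>: "\<mu> > 0"
    "\<And>b. b > 0 \<Longrightarrow> Lp_norm q (\<lambda>x::'a. ennreal (exp (- pi * b * (norm x)\<^sup>2))) = ennreal (\<mu> * b powr (- e q))"
    using Lp_norm_gaussian[OF q] unfolding e_def by metis
  \<comment> \<open>Since \<open>\<bar>y\<bar>\<^sup>2 \<le> 2 \<bar>x\<bar>\<^sup>2 + 2 \<bar>x - y\<bar>\<^sup>2\<close>, decay \<open>\<delta> / 2\<close> in \<open>y\<close> costs decay \<open>\<delta>\<close> in \<open>x\<close> and in
    \<open>x - y\<close>; the available amounts are \<open>a / 2 \<ge> 1 / 2\<close> and \<open>\<epsilon>\<close>.\<close>
  define \<delta> where "\<delta> = min (1 / 2) \<epsilon>"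
  have \<delta>: "\<delta> > 0" "\<delta> \<le> 1 / 2" "\<delta> \<le> \<epsilon>" using M by (auto simp: \<delta>_def)
  note cont = continuous_amalgam_window[OF g]
  have [measurable]: "g \<in> borel_measurable borel"
    by (rule borel_measurable_continuous_onI[OF cont])
  show ?thesis
  proof (rule that[of "M * \<kappa> * (1 / 2) powr (- e p) * \<mu> * (\<delta> / 2) powr (- e q)"])
    fix a :: real assume a: "a \<ge> 1"
    define K where "K = M * (\<kappa> * (a / 2) powr (- e p))"
    have K: "K > 0" using M a \<kappa> by (simp add: K_def)
    have pointwise: "norm (gaussian a x * g (x - y))
        \<le> (M * exp (- pi * (\<delta> / 2) * (norm y)\<^sup>2)) * exp (- pi * (a / 2) * (norm x)\<^sup>2)" for x y :: 'a
    proof -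
      have "0 \<le> (norm (x + (x - y)))\<^sup>2" by simp
      then have "(norm y)\<^sup>2 \<le> 2 * (norm x)\<^sup>2 + 2 * (norm (x - y))\<^sup>2"
        unfolding power2_norm_eq_inner by (simp add: inner_simps inner_commute)
      then have "\<delta> / 2 * (norm y)\<^sup>2 \<le> \<delta> / 2 * (2 * (norm x)\<^sup>2 + 2 * (norm (x - y))\<^sup>2)"
        using \<delta> by (intro mult_left_mono) auto
      also have "\<dots> = \<delta> * (norm x)\<^sup>2 + \<delta> * (norm (x - y))\<^sup>2"
        by (simp add: algebra_simps)
      also have "\<dots> \<le> a / 2 * (norm x)\<^sup>2 + \<epsilon> * (norm (x - y))\<^sup>2"
        using \<delta> a by (intro add_mono mult_right_mono) auto
      finally have "pi * (\<delta> / 2 * (norm y)\<^sup>2) \<le> pi * (a / 2 * (norm x)\<^sup>2 + \<epsilon> * (norm (x - y))\<^sup>2)"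
        by (intro mult_left_mono) auto
      then have "- pi * a * (norm x)\<^sup>2 + - pi * \<epsilon> * (norm (x - y))\<^sup>2
          \<le> - pi * (\<delta> / 2) * (norm y)\<^sup>2 + - pi * (a / 2) * (norm x)\<^sup>2"
        by (simp add: algebra_simps)
      then have "exp (- pi * a * (norm x)\<^sup>2) * exp (- pi * \<epsilon> * (norm (x - y))\<^sup>2)
          \<le> exp (- pi * (\<delta> / 2) * (norm y)\<^sup>2) * exp (- pi * (a / 2) * (norm x)\<^sup>2)"
        by (simp only: exp_le_cancel_iff flip: exp_add)
      then have "M * (exp (- pi * a * (norm x)\<^sup>2) * exp (- pi * \<epsilon> * (norm (x - y))\<^sup>2))
          \<le> M * (exp (- pi * (\<delta> / 2) * (norm y)\<^sup>2) * exp (- pi * (a / 2) * (norm x)\<^sup>2))"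
        using M by (intro mult_left_mono) auto
      moreover have "exp (- pi * a * (norm x)\<^sup>2) * norm (g (x - y))
          \<le> exp (- pi * a * (norm x)\<^sup>2) * (M * exp (- pi * \<epsilon> * (norm (x - y))\<^sup>2))"
        using M(3) by (intro mult_left_mono) auto
      ultimately show ?thesis
        unfolding norm_mult norm_gaussian by (simp only: mult_ac)
    qed
    have "amalgam_norm g p q (gaussian a)
        \<le> Lp_norm q (\<lambda>y::'a. ennreal K * ennreal (exp (- pi * (\<delta> / 2) * (norm y)\<^sup>2)))"
      unfolding amalgam_norm_def
    proof (rule Lp_norm_mono)
      show "(\<lambda>y. Lp_norm p (\<lambda>x. ennreal (norm (gaussian a x * g (x - y))))) \<in> borel_measurable borel"
        unfolding norm_mult
        by (intro borel_measurable_Lp_norm_translates p continuous_intros continuous_gaussian cont)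
      fix y :: 'a
      have "Lp_norm p (\<lambda>x. ennreal (norm (gaussian a x * g (x - y))))
          \<le> Lp_norm p (\<lambda>x::'a. ennreal (M * exp (- pi * (\<delta> / 2) * (norm y)\<^sup>2)) * ennreal (exp (- pi * (a / 2) * (norm x)\<^sup>2)))"
      proof (rule Lp_norm_mono)
        show "(\<lambda>x. ennreal (norm (gaussian a x * g (x - y)))) \<in> borel_measurable borel"
          unfolding gaussian_def by measurable
        show "ennreal (norm (gaussian a x * g (x - y)))
          \<le> ennreal (M * exp (- pi * (\<delta> / 2) * (norm y)\<^sup>2)) * ennreal (exp (- pi * (a / 2) * (norm x)\<^sup>2))" for x
          using pointwise M by (subst ennreal_mult[symmetric]) (auto intro: ennreal_leI)
      qed
      also have "\<dots> = ennreal (M * exp (- pi * (\<delta> / 2) * (norm y)\<^sup>2)) * ennreal (\<kappa> * (a / 2) powr (- e p))"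
        using M a p \<kappa>(2)[of "a / 2"] by (subst Lp_norm_cmult) auto
      also have "\<dots> = ennreal K * ennreal (exp (- pi * (\<delta> / 2) * (norm y)\<^sup>2))"
        using M \<kappa>(1) a by (simp add: K_def mult_ac flip: ennreal_mult)
      finally show "Lp_norm p (\<lambda>x. ennreal (norm (gaussian a x * g (x - y))))
          \<le> ennreal K * ennreal (exp (- pi * (\<delta> / 2) * (norm y)\<^sup>2))" .
    qed
    also have "\<dots> = ennreal K * ennreal (\<mu> * (\<delta> / 2) powr (- e q))"
      using K q \<mu>(2)[of "\<delta> / 2"] \<delta> by (subst Lp_norm_cmult) auto
    also have "\<dots> = ennreal (M * \<kappa> * (1 / 2) powr (- e p) * \<mu> * (\<delta> / 2) powr (- e q) * a powr (- e p))"
    proof -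
      have "(a / 2) powr (- e p) = (1 / 2) powr (- e p) * a powr (- e p)"
        using a by (simp flip: powr_mult)
      then show ?thesis
        using K \<mu>(1) by (subst ennreal_mult[symmetric]) (auto simp: K_def mult_ac)
    qed
    finally show "amalgam_norm g p q (gaussian a) \<le> ennreal (M * \<kappa> * (1 / 2) powr (- e p) * \<mu> * (\<delta> / 2) powr (- e q)
      * a powr (- (real DIM('a) / 2 * enn2real (1 / p))))"
      by (simp add: e_def)
  qed (use M \<kappa> \<mu> \<delta> in auto)
qed

text \<open>An amalgam norm depends only on the modulus of the function, so the phase of a propagated Gaussian
  is irrelevant.\<close>

lemma amalgam_norm_scale:
  fixes f g h :: "'a::euclidean_space \<Rightarrow> complex"
  assumes p: "1 \<le> p" and q: "1 \<le> q" and g: "continuous_on UNIV g" and h: "continuous_on UNIV h"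
    and K: "K > 0" and f: "\<And>x. norm (f x) = K * norm (h x)"
  shows "amalgam_norm g p q f = ennreal K * amalgam_norm g p q h"
proof -
  have [measurable]: "g \<in> borel_measurable borel" "h \<in> borel_measurable borel"
    by (auto intro: borel_measurable_continuous_onI g h)
  have "Lp_norm p (\<lambda>x. ennreal (norm (f x * g (x - y))))
      = Lp_norm p (\<lambda>x. ennreal K * ennreal (norm (h x * g (x - y))))" for y
    using K by (simp add: norm_mult f mult.assoc flip: ennreal_mult)
  also have "\<dots> y = ennreal K * Lp_norm p (\<lambda>x. ennreal (norm (h x * g (x - y))))" for y
    using K p by (intro Lp_norm_cmult) auto
  finally have inner: "Lp_norm p (\<lambda>x. ennreal (norm (f x * g (x - y))))
      = ennreal K * Lp_norm p (\<lambda>x. ennreal (norm (h x * g (x - y))))" for y .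
  have "(\<lambda>y. Lp_norm p (\<lambda>x. ennreal (norm (h x * g (x - y))))) \<in> borel_measurable borel"
    unfolding norm_mult
    by (intro borel_measurable_Lp_norm_translates p continuous_intros g h)
  then show ?thesis
    unfolding amalgam_norm_def inner using K q by (intro Lp_norm_cmult) auto
qed

section \<open>Gaussians as Schwartz functions\<close>

lemma real_polynomial_partial_derivative:
  fixes p :: "'a::euclidean_space \<Rightarrow> real"
  assumes "real_polynomial_function p"
  shows "\<exists>q. real_polynomial_function q \<and> (\<forall>x. \<exists>D. (p has_derivative D) (at x) \<and> D b = q x)"
  using assms
proof induction
  case (linear f)
  then show ?case
    by (intro exI[of _ "\<lambda>_. f b"]) (auto intro: bounded_linear_imp_has_derivative)
next
  case (const c)
  show ?case by (intro exI[of _ "\<lambda>_. 0"] conjI allI exI[of _ "\<lambda>_. 0::real"]) auto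
next
  case (add f g)
  then obtain f' g' where f': "real_polynomial_function f'" "\<And>x. \<exists>D. (f has_derivative D) (at x) \<and> D b = f' x"
    and g': "real_polynomial_function g'" "\<And>x. \<exists>D. (g has_derivative D) (at x) \<and> D b = g' x" by blast
  have "\<exists>D. ((\<lambda>x. f x + g x) has_derivative D) (at x) \<and> D b = f' x + g' x" for x
  proof -
    obtain D E where "(f has_derivative D) (at x)" "D b = f' x" "(g has_derivative E) (at x)" "E b = g' x"
      using f'(2) g'(2) by blast
    then show ?thesis by (intro exI[of _ "\<lambda>y. D y + E y"]) (auto intro: has_derivative_add)
  qed
  then show ?case using f' g' by (intro exI[of _ "\<lambda>x. f' x + g' x"]) auto
next
  case (mult f g)
  then obtain f' g' where f': "real_polynomial_function f'" "\<And>x. \<exists>D. (f has_derivative D) (at x) \<and> D b = f' x"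
    and g': "real_polynomial_function g'" "\<And>x. \<exists>D. (g has_derivative D) (at x) \<and> D b = g' x" by blast
  have "\<exists>D. ((\<lambda>x. f x * g x) has_derivative D) (at x) \<and> D b = f x * g' x + f' x * g x" for x
  proof -
    obtain D E where "(f has_derivative D) (at x)" "D b = f' x" "(g has_derivative E) (at x)" "E b = g' x"
      using f'(2) g'(2) by blast
    then show ?thesis by (intro exI[of _ "\<lambda>y. f x * E y + D y * g x"]) (auto intro: has_derivative_mult)
  qed
  then show ?case using f' g' mult.hyps by (intro exI[of _ "\<lambda>x. f x * g' x + f' x * g x"]) auto
qed

lemma real_polynomial_growth:
  fixes p :: "'a::euclidean_space \<Rightarrow> real"
  assumes "real_polynomial_function p"
  shows "\<exists>C n. C \<ge> 0 \<and> (\<forall>x. \<bar>p x\<bar> \<le> C * (1 + norm x) ^ n)"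
  using assms
proof induction
  case (linear f)
  then obtain K where K: "K \<ge> 0" "\<And>x. norm (f x) \<le> norm x * K"
    using bounded_linear.nonneg_bounded by blast
  have "\<bar>f x\<bar> \<le> K * (1 + norm x) ^ 1" for x
    using K(2)[of x] K(1) by (simp add: algebra_simps)
  then show ?case using K(1) by blast
next
  case (const c)
  show ?case by (rule exI[of _ "\<bar>c\<bar>"], rule exI[of _ 0]) auto
next
  case (add f g)
  then obtain C n D m where C: "C \<ge> 0" "\<And>x. \<bar>f x\<bar> \<le> C * (1 + norm x) ^ n"
    and D: "D \<ge> 0" "\<And>x. \<bar>g x\<bar> \<le> D * (1 + norm x) ^ m" by blast
  have "\<bar>f x + g x\<bar> \<le> (C + D) * (1 + norm x) ^ (n + m)" for x
  proof -
    have "\<bar>f x + g x\<bar> \<le> C * (1 + norm x) ^ n + D * (1 + norm x) ^ m"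
      using C(2)[of x] D(2)[of x] by linarith
    also have "\<dots> \<le> C * (1 + norm x) ^ (n + m) + D * (1 + norm x) ^ (n + m)"
      using C(1) D(1) by (intro add_mono mult_left_mono power_increasing) auto
    finally show ?thesis by (simp add: algebra_simps)
  qed
  then show ?case using C(1) D(1) by (meson add_nonneg_nonneg)
next
  case (mult f g)
  then obtain C n D m where C: "C \<ge> 0" "\<And>x. \<bar>f x\<bar> \<le> C * (1 + norm x) ^ n"
    and D: "D \<ge> 0" "\<And>x. \<bar>g x\<bar> \<le> D * (1 + norm x) ^ m" by blast
  have "\<bar>f x * g x\<bar> \<le> (C * D) * (1 + norm x) ^ (n + m)" for x
  proof -
    have "\<bar>f x * g x\<bar> \<le> (C * (1 + norm x) ^ n) * (D * (1 + norm x) ^ m)"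
      unfolding abs_mult using C D by (intro mult_mono) auto
    then show ?thesis by (simp add: power_add algebra_simps)
  qed
  then show ?case using C(1) D(1) by (meson mult_nonneg_nonneg)
qed

text \<open>Differentiating a polynomial times a Gaussian gives again a polynomial times the same Gaussian.\<close>

lemma iter_partial_gaussian:
  "\<exists>p. real_polynomial_function p \<and>
     iter_partial bs (gaussian a) = (\<lambda>x::'a::euclidean_space. complex_of_real (p x) * gaussian a x)"
proof (induction bs)
  case Nil
  show ?case by (rule exI[of _ "\<lambda>_. 1"]) auto
next
  case (Cons b bs)
  then obtain p where p: "real_polynomial_function p"
    "iter_partial bs (gaussian a) = (\<lambda>x::'a. complex_of_real (p x) * gaussian a x)" by blast
  obtain q where q: "real_polynomial_function q" "\<And>x. \<exists>D. (p has_derivative D) (at x) \<and> D b = q x"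
    using real_polynomial_partial_derivative[OF p(1), of b] by blast
  define r where "r x = q x + p x * (- 2 * pi * a * (x \<bullet> b))" for x
  have "real_polynomial_function r"
    unfolding r_def by (rule real_polynomial_function.intros(3)[OF q(1)
      real_polynomial_function.intros(4)[OF p(1) real_polynomial_function.intros(4)[OF
        real_polynomial_function.intros(2) real_polynomial_function.intros(1)[OF bounded_linear_inner_left]]]])
  moreover have "frechet_derivative (\<lambda>x. complex_of_real (p x) * gaussian a x) (at x) b
      = complex_of_real (r x) * gaussian a x" for x :: 'a
  proof -
    obtain D where D: "(p has_derivative D) (at x)" "D b = q x" using q(2) by blast
    have "((\<lambda>x. complex_of_real (p x * exp (- pi * a * (x \<bullet> x)))) has_derivative
        (\<lambda>h. complex_of_real (D h * exp (- pi * a * (x \<bullet> x))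
           + p x * (exp (- pi * a * (x \<bullet> x)) * (- pi * a * (h \<bullet> x + x \<bullet> h)))))) (at x)"
      by (auto intro!: derivative_eq_intros D(1) simp: algebra_simps)
    then have "frechet_derivative (\<lambda>x. complex_of_real (p x * exp (- pi * a * (x \<bullet> x)))) (at x) b
        = complex_of_real (D b * exp (- pi * a * (x \<bullet> x))
           + p x * (exp (- pi * a * (x \<bullet> x)) * (- pi * a * (b \<bullet> x + x \<bullet> b))))"
      by (simp add: frechet_derivative_at[symmetric])
    then show ?thesis
      unfolding gaussian_def power2_norm_eq_inner D(2) r_def
      by (simp add: inner_commute algebra_simps)
  qed
  ultimately show ?case
    by (intro exI[of _ r]) (simp add: p(2))
qed

text \<open>Bound \<open>1 + t\<close> by \<open>exp t\<close> and complete the square.\<close>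

lemma polynomial_gaussian_bounded:
  assumes "a > 0" "t \<ge> 0"
  shows "(1 + t) ^ n * exp (- pi * a * t\<^sup>2) \<le> exp ((real n)\<^sup>2 / (4 * pi * a))"
proof -
  have "(1 + t) ^ n \<le> exp t ^ n"
    using assms by (intro power_mono) (auto intro: exp_ge_add_one_self)
  also have "\<dots> = exp (real n * t)" by (simp add: exp_of_nat_mult)
  finally have "(1 + t) ^ n * exp (- pi * a * t\<^sup>2) \<le> exp (real n * t) * exp (- pi * a * t\<^sup>2)"
    by (intro mult_right_mono) auto
  also have "\<dots> = exp (real n * t - pi * a * t\<^sup>2)" by (simp flip: exp_add)
  also have "real n * t - pi * a * t\<^sup>2 \<le> (real n)\<^sup>2 / (4 * pi * a)"
  proof -
    have "0 \<le> (real n - 2 * pi * a * t)\<^sup>2" by simp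
    then have "(real n * t - pi * a * t\<^sup>2) * (4 * pi * a) \<le> (real n)\<^sup>2"
      by (simp add: power2_eq_square algebra_simps)
    then show ?thesis using assms by (simp add: pos_le_divide_eq)
  qed
  finally show ?thesis by simp
qed

lemma schwartz_gaussian:
  assumes "a > 0"
  shows "schwartz_fun (gaussian a :: 'a::euclidean_space \<Rightarrow> complex)"
  unfolding schwartz_fun_def smooth_fun_def
proof safe
  fix bs :: "'a list" and x :: 'a
  obtain p where p: "real_polynomial_function p"
    "iter_partial bs (gaussian a) = (\<lambda>x::'a. complex_of_real (p x) * gaussian a x)"
    using iter_partial_gaussian by blast
  obtain D where D: "(p has_derivative D) (at x)"
    using real_polynomial_partial_derivative[OF p(1)] by blast
  have "((\<lambda>x. complex_of_real (p x * exp (- pi * a * (x \<bullet> x)))) has_derivative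
        (\<lambda>h. complex_of_real (D h * exp (- pi * a * (x \<bullet> x))
           + p x * (exp (- pi * a * (x \<bullet> x)) * (- pi * a * (h \<bullet> x + x \<bullet> h)))))) (at x)"
    by (auto intro!: derivative_eq_intros D simp: algebra_simps)
  then show "iter_partial bs (gaussian a) differentiable at x"
    unfolding p(2) gaussian_def power2_norm_eq_inner of_real_mult[symmetric]
    by (rule differentiableI)
next
  fix bs :: "'a list" and k :: nat
  obtain p where p: "real_polynomial_function p"
    "iter_partial bs (gaussian a) = (\<lambda>x::'a. complex_of_real (p x) * gaussian a x)"
    using iter_partial_gaussian by blast
  obtain C n where C: "C \<ge> 0" "\<And>x. \<bar>p x\<bar> \<le> C * (1 + norm x) ^ n"
    using real_polynomial_growth[OF p(1)] by blast
  have "norm x ^ k * norm (iter_partial bs (gaussian a) x) \<le> C * exp ((real (k + n))\<^sup>2 / (4 * pi * a))" for x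
  proof -
    have "norm x ^ k * norm (iter_partial bs (gaussian a) x)
        = norm x ^ k * \<bar>p x\<bar> * exp (- pi * a * (norm x)\<^sup>2)"
      by (simp add: p(2) norm_mult norm_gaussian)
    also have "\<dots> \<le> (1 + norm x) ^ k * (C * (1 + norm x) ^ n) * exp (- pi * a * (norm x)\<^sup>2)"
      using C by (intro mult_right_mono mult_mono power_mono) auto
    also have "\<dots> = C * ((1 + norm x) ^ (k + n) * exp (- pi * a * (norm x)\<^sup>2))"
      by (simp add: power_add)
    also have "\<dots> \<le> C * exp ((real (k + n))\<^sup>2 / (4 * pi * a))"
      using C(1) assms by (intro mult_left_mono polynomial_gaussian_bounded) auto
    finally show ?thesis .
  qed
  then show "\<exists>B. \<forall>x. norm x ^ k * norm (iter_partial bs (gaussian a) x) \<le> B" by blast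
qed

section \<open>The sharp decay rate and the necessary condition on the exponents\<close>

lemma conj_exponent_ge_1:
  assumes "1 \<le> p"
  shows "1 \<le> conj_exponent p"
proof (rule ccontr)
  assume "\<not> 1 \<le> conj_exponent p"
  then obtain x where x: "conj_exponent p = ennreal x" "0 \<le> x" "x < 1"
    by (cases "conj_exponent p") (auto simp: not_le)
  have "1 < 1 / conj_exponent p"
  proof (cases "x = 0")
    case True
    then show ?thesis using x by (simp add: divide_ennreal_def)
  next
    case False
    then have "1 / conj_exponent p = ennreal (1 / x)"
      using x by (simp add: divide_ennreal flip: ennreal_1)
    then show ?thesis using x False by simp
  qed
  moreover have "1 / conj_exponent p \<le> 1 / p + 1 / conj_exponent p" by simp
  ultimately show False
    unfolding conj_exponent_sum[OF assms] by simp
qed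

lemma enn2real_inverse_conj_exponent:
  assumes "1 \<le> p"
  shows "enn2real (1 / conj_exponent p) = 1 - enn2real (1 / p)"
proof -
  have fin: "1 / p < \<infinity>" "1 / conj_exponent p < \<infinity>"
    using conj_exponent_sum[OF assms] ennreal_add_eq_top ennreal_one_neq_top by (auto simp: less_top[symmetric])
  have "enn2real (1 / p + 1 / conj_exponent p) = enn2real (1 / p) + enn2real (1 / conj_exponent p)"
    using fin by (intro enn2real_plus) auto
  then show ?thesis unfolding conj_exponent_sum[OF assms] by simp
qed

lemma enn2real_inverse_strict_antimono:
  fixes p q :: ennreal
  assumes "1 \<le> p" "p < q"
  shows "enn2real (1 / q) < enn2real (1 / p)"
proof -
  have q: "1 \<le> q" using assms by simp
  obtain x where x: "x \<ge> 1" "p = ennreal x" "enn2real (1 / p) = 1 / x"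
    using assms(1,2) by (elim exponent_cases) auto
  show ?thesis
    using q
  proof (cases rule: exponent_cases)
    case 1
    then show ?thesis using x by simp
  next
    case (2 r)
    then have "x < r" using assms(2) x by (simp add: ennreal_less_iff)
    then show ?thesis using 2 x by (simp add: frac_less2)
  qed
qed

text \<open>With \<open>c = 4 \<pi>\<close> and the time as variable, or with \<open>c = 4 \<pi> t\<close> and the parameter of the datum as
  variable, these give the size of \<open>D = 1 + (c x)\<^sup>2\<close> and of the parameter of the propagated
  Gaussian.\<close>

lemma quadratic_ratio_tendsto:
  fixes c :: real
  assumes "c \<noteq> 0"
  shows "((\<lambda>x. (1 + (c * x)\<^sup>2) / x\<^sup>2) \<longlongrightarrow> c\<^sup>2) at_top"
    and "filterlim (\<lambda>x. 1 / (1 + (c * x)\<^sup>2)) (at_right 0) at_top"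
    and "filterlim (\<lambda>x. x / (1 + (c * x)\<^sup>2)) (at_right 0) at_top"
proof -
  have inv: "((\<lambda>x::real. 1 / x) \<longlongrightarrow> 0) at_top"
    by (intro tendsto_divide_0[OF tendsto_const] filterlim_ident filterlim_at_top_imp_at_infinity)
  have pos: "0 < 1 + (c * x)\<^sup>2" for x by (simp add: add_pos_nonneg)
  have ev: "eventually (\<lambda>x::real. x > 0) at_top" by (rule eventually_gt_at_top)
  have "((\<lambda>x. c\<^sup>2 + (1 / x)\<^sup>2) \<longlongrightarrow> c\<^sup>2) at_top"
    using tendsto_add[OF tendsto_const tendsto_power[OF inv, of 2], of "c\<^sup>2"] by simp
  moreover have "eventually (\<lambda>x. c\<^sup>2 + (1 / x)\<^sup>2 = (1 + (c * x)\<^sup>2) / x\<^sup>2) at_top"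
    using ev by eventually_elim (simp add: field_simps power_mult_distrib)
  ultimately show R: "((\<lambda>x. (1 + (c * x)\<^sup>2) / x\<^sup>2) \<longlongrightarrow> c\<^sup>2) at_top"
    by (rule Lim_transform_eventually)
  have "((\<lambda>x. (1 / x)\<^sup>2 / ((1 + (c * x)\<^sup>2) / x\<^sup>2)) \<longlongrightarrow> 0) at_top"
    using tendsto_divide[OF tendsto_power[OF inv, of 2] R] assms by simp
  moreover have "eventually (\<lambda>x. (1 / x)\<^sup>2 / ((1 + (c * x)\<^sup>2) / x\<^sup>2) = 1 / (1 + (c * x)\<^sup>2)) at_top"
    using ev by eventually_elim (simp add: power_divide)
  ultimately have "((\<lambda>x. 1 / (1 + (c * x)\<^sup>2)) \<longlongrightarrow> 0) at_top"
    by (rule Lim_transform_eventually)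
  then show "filterlim (\<lambda>x. 1 / (1 + (c * x)\<^sup>2)) (at_right 0) at_top"
    by (rule tendsto_imp_filterlim_at_right) (simp add: pos)
  have "((\<lambda>x. (1 / x) / ((1 + (c * x)\<^sup>2) / x\<^sup>2)) \<longlongrightarrow> 0) at_top"
    using tendsto_divide[OF inv R] assms by simp
  moreover have "eventually (\<lambda>x. (1 / x) / ((1 + (c * x)\<^sup>2) / x\<^sup>2) = x / (1 + (c * x)\<^sup>2)) at_top"
    using ev by eventually_elim (simp add: power2_eq_square)
  ultimately have "((\<lambda>x. x / (1 + (c * x)\<^sup>2)) \<longlongrightarrow> 0) at_top"
    by (rule Lim_transform_eventually)
  then show "filterlim (\<lambda>x. x / (1 + (c * x)\<^sup>2)) (at_right 0) at_top"
    by (rule tendsto_imp_filterlim_at_right) (use ev in eventually_elim, simp add: pos)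
qed

lemma amalgam_norm_schrodinger_gaussian:
  fixes g :: "'a::euclidean_space \<Rightarrow> complex"
  assumes g: "amalgam_window g" and p: "1 \<le> p" and q: "1 \<le> q" and a: "a > 0"
  shows "amalgam_norm g p q (schrodinger t (gaussian a)) =
    ennreal ((1 + (4 * pi * a * t)\<^sup>2) powr (- real DIM('a) / 4))
      * amalgam_norm g p q (gaussian (a / (1 + (4 * pi * a * t)\<^sup>2)))"
proof (rule amalgam_norm_scale[OF p q continuous_amalgam_window[OF g] continuous_gaussian])
  have "1 + (4 * pi * a * t)\<^sup>2 > 0" by (simp add: add_pos_nonneg)
  then show "(1 + (4 * pi * a * t)\<^sup>2) powr (- real DIM('a) / 4) > 0" by simp
qed (simp only: norm_schrodinger_gaussian[OF a] norm_gaussian)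

text \<open>The propagated Gaussian has parameter \<open>1 / D\<close> and peak \<open>D\<close> to the power \<open>- d / 4\<close>, where \<open>D\<close> is
  \<open>1 + (4 \<pi> t)\<^sup>2\<close>. Its norm is therefore \<open>L\<close> times \<open>D\<close> to the power \<open>\<rho> = d / 2 * (1 / q - 1 / 2)\<close>
  asymptotically, and \<open>D\<close> grows like \<open>(4 \<pi> t)\<^sup>2\<close>.\<close>

lemma amalgam_norm_schrodinger_gaussian_asymptotics:
  fixes g :: "'a::euclidean_space \<Rightarrow> complex"
  assumes g: "amalgam_window g" and p: "1 \<le> p" and q: "1 \<le> q"
  shows "\<exists>C::real. C > 0 \<and>
    ((\<lambda>t::real. amalgam_norm g p q (schrodinger t (gaussian 1))
       / ennreal (C * t powr (real DIM('a) * (enn2real (1 / q) - 1 / 2)))) \<longlongrightarrow> 1) at_top"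
proof -
  define e where "e = real DIM('a) / 2 * enn2real (1 / q)"
  define \<rho> where "\<rho> = e - real DIM('a) / 4"
  obtain L where L: "L > 0"
    "((\<lambda>s. amalgam_norm g p q (gaussian s) * ennreal (s powr e)) \<longlongrightarrow> ennreal L) (at_right 0)"
    using amalgam_norm_wide_gaussian[OF g p q] unfolding e_def by metis
  define C where "C = L * ((4 * pi)\<^sup>2) powr \<rho>"
  have C: "C > 0" using L by (simp add: C_def)
  define D where "D t = 1 + (4 * pi * t)\<^sup>2" for t
  have D: "D t > 0" for t by (simp add: D_def add_pos_nonneg)
  have c: "4 * pi \<noteq> 0" by simp
  have lim1: "((\<lambda>t. amalgam_norm g p q (gaussian (1 / D t)) * ennreal ((1 / D t) powr e)) \<longlongrightarrow> ennreal L) at_top"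
    using filterlim_compose[OF L(2) quadratic_ratio_tendsto(2)[OF c]] unfolding D_def .
  have "((\<lambda>t. (D t / t\<^sup>2) powr \<rho> / C) \<longlongrightarrow> ((4 * pi)\<^sup>2) powr \<rho> / C) at_top"
    using quadratic_ratio_tendsto(1)[OF c] C unfolding D_def
    by (intro tendsto_divide tendsto_powr tendsto_const) auto
  also have "((4 * pi)\<^sup>2) powr \<rho> / C = 1 / L" using L by (simp add: C_def)
  finally have lim2: "((\<lambda>t. (D t / t\<^sup>2) powr \<rho> / C) \<longlongrightarrow> 1 / L) at_top" .
  have "((\<lambda>t. amalgam_norm g p q (gaussian (1 / D t)) * ennreal ((1 / D t) powr e)
      * ennreal ((D t / t\<^sup>2) powr \<rho> / C)) \<longlongrightarrow> ennreal L * ennreal (1 / L)) at_top"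
    by (intro tendsto_mult_ennreal tendsto_ennrealI lim1 lim2) (use L in auto)
  moreover have "ennreal L * ennreal (1 / L) = 1"
    using L by (simp flip: ennreal_mult)
  moreover have "eventually (\<lambda>t. amalgam_norm g p q (gaussian (1 / D t)) * ennreal ((1 / D t) powr e)
        * ennreal ((D t / t\<^sup>2) powr \<rho> / C)
      = amalgam_norm g p q (schrodinger t (gaussian 1))
        / ennreal (C * t powr (real DIM('a) * (enn2real (1 / q) - 1 / 2)))) at_top"
    using eventually_gt_at_top[of 0]
  proof eventually_elim
    case (elim t)
    let ?T = "t powr (real DIM('a) * (enn2real (1 / q) - 1 / 2))"
    have T: "(t\<^sup>2) powr \<rho> = ?T"
      using elim by (simp add: \<rho>_def e_def powr_powr algebra_simps flip: powr_numeral)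
    have "(1 / D t) powr e * ((D t / t\<^sup>2) powr \<rho> / C) = D t powr (- e) * D t powr \<rho> / (C * ?T)"
      using D[of t] elim by (simp add: powr_divide T powr_minus_divide)
    also have "\<dots> = D t powr (- real DIM('a) / 4) / (C * ?T)"
      by (simp add: \<rho>_def flip: powr_add)
    finally have K: "(1 / D t) powr e * ((D t / t\<^sup>2) powr \<rho> / C) = D t powr (- real DIM('a) / 4) / (C * ?T)" .
    have S: "amalgam_norm g p q (schrodinger t (gaussian 1))
        = ennreal (D t powr (- real DIM('a) / 4)) * amalgam_norm g p q (gaussian (1 / D t))"
      using amalgam_norm_schrodinger_gaussian[OF g p q, of 1 t] by (simp add: D_def)
    have "amalgam_norm g p q (gaussian (1 / D t)) * ennreal ((1 / D t) powr e) * ennreal ((D t / t\<^sup>2) powr \<rho> / C)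
        = amalgam_norm g p q (gaussian (1 / D t)) * ennreal (D t powr (- real DIM('a) / 4) / (C * ?T))"
    proof -
      have "ennreal ((1 / D t) powr e) * ennreal ((D t / t\<^sup>2) powr \<rho> / C)
          = ennreal (D t powr (- real DIM('a) / 4) / (C * ?T))"
        unfolding K[symmetric] by (rule ennreal_mult[symmetric]) (use C in auto)
      then show ?thesis by (simp only: mult.assoc)
    qed
    also have "ennreal (D t powr (- real DIM('a) / 4) / (C * ?T))
        = ennreal (D t powr (- real DIM('a) / 4)) / ennreal (C * ?T)"
      using C elim by (simp add: divide_ennreal)
    finally show ?case
      unfolding S by (simp add: ennreal_times_divide mult.commute)
  qed
  ultimately have "((\<lambda>t. amalgam_norm g p q (schrodinger t (gaussian 1))
       / ennreal (C * t powr (real DIM('a) * (enn2real (1 / q) - 1 / 2)))) \<longlongrightarrow> 1) at_top"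
    by (auto elim: Lim_transform_eventually)
  then show ?thesis using C by blast
qed

text \<open>Let \<open>a \<rightarrow> \<infinity>\<close> at the fixed time \<open>t\<close>. The datum is narrow, with norm at most of order \<open>a\<close> to the power
  \<open>- d / 2 * (1 - 1 / p)\<close>. It spreads to a Gaussian of parameter of order \<open>1 / a\<close> and peak of order
  \<open>a\<close> to the power \<open>- d / 2\<close>, with norm of order \<open>a\<close> to the power \<open>d / 2 * (1 / q - 1)\<close>. The estimate
  bounds the quotient of the two, a power of \<open>a\<close> with exponent \<open>\<sigma> = d / 2 * (1 / q - 1 / p)\<close>, which
  is impossible if \<open>\<sigma> > 0\<close>.\<close>

lemma amalgam_fixed_time_estimate_exponents:
  fixes g :: "'a::euclidean_space \<Rightarrow> complex"
  assumes g: "amalgam_window g" and t: "t \<noteq> 0" and p: "1 \<le> p" and q: "1 \<le> q" and C: "C > 0"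
    and estimate: "\<And>a. a \<ge> 1 \<Longrightarrow> amalgam_norm g p q (schrodinger t (gaussian a))
      \<le> ennreal C * amalgam_norm g (conj_exponent p) (conj_exponent q) (gaussian a)"
  shows "p \<le> q"
proof (rule ccontr)
  assume "\<not> p \<le> q"
  then have less: "enn2real (1 / p) < enn2real (1 / q)"
    using q by (intro enn2real_inverse_strict_antimono) auto
  define d where "d = real DIM('a)"
  define e where "e = d / 2 * enn2real (1 / q)"
  define f where "f = d / 2 * (1 - enn2real (1 / p))"
  define \<sigma> where "\<sigma> = d / 2 * (enn2real (1 / q) - enn2real (1 / p))"
  have \<sigma>: "\<sigma> > 0" using less by (simp add: \<sigma>_def d_def)
  obtain L where L: "L > 0"
    "((\<lambda>s. amalgam_norm g p q (gaussian s) * ennreal (s powr e)) \<longlongrightarrow> ennreal L) (at_right 0)"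
    using amalgam_norm_wide_gaussian[OF g p q] unfolding e_def d_def by metis
  obtain B where B: "B > 0" "\<And>a. a \<ge> 1 \<Longrightarrow>
      amalgam_norm g (conj_exponent p) (conj_exponent q) (gaussian a) \<le> ennreal (B * a powr (- f))"
    using amalgam_norm_narrow_gaussian[OF g conj_exponent_ge_1[OF p] conj_exponent_ge_1[OF q]]
    unfolding enn2real_inverse_conj_exponent[OF p] f_def d_def by metis
  define c where "c = 4 * pi * t"
  have c: "c \<noteq> 0" using t by (simp add: c_def)
  define D where "D a = 1 + (c * a)\<^sup>2" for a
  have D: "D a > 0" for a by (simp add: D_def add_pos_nonneg)
  have "((\<lambda>a. amalgam_norm g p q (gaussian (a / D a)) * ennreal ((a / D a) powr e)) \<longlongrightarrow> ennreal L) at_top"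
    using filterlim_compose[OF L(2) quadratic_ratio_tendsto(3)[OF c]] unfolding D_def .
  then have "eventually (\<lambda>a. ennreal (L / 2) < amalgam_norm g p q (gaussian (a / D a)) * ennreal ((a / D a) powr e)) at_top"
    by (rule order_tendstoD(1)) (use L in \<open>simp add: ennreal_less_iff\<close>)
  then have "eventually (\<lambda>a. (D a / a\<^sup>2) powr (e - d / 4) * a powr \<sigma> \<le> 2 * C * B / L) at_top"
    using eventually_ge_at_top[of 1]
  proof eventually_elim
    case (elim a)
    then have a: "a > 0" by simp
    define s where "s = a / D a"
    define K where "K = D a powr (- d / 4)"
    have s: "s > 0" and K: "K > 0" using a D[of a] by (simp_all add: s_def K_def)
    have "ennreal (L / 2 * (s powr (- e) * K)) = ennreal (L / 2) * ennreal (s powr (- e) * K)"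
      using L(1) by (simp flip: ennreal_mult')
    also have "\<dots> \<le> (amalgam_norm g p q (gaussian s) * ennreal (s powr e)) * ennreal (s powr (- e) * K)"
      using elim unfolding s_def by (intro mult_right_mono) auto
    also have "\<dots> = ennreal K * amalgam_norm g p q (gaussian s)"
    proof -
      have cancel: "ennreal (s powr e) * ennreal (s powr (- e) * K) = ennreal K"
        using s K by (simp add: powr_minus flip: ennreal_mult)
      show ?thesis unfolding mult.assoc cancel by (rule mult.commute)
    qed
    also have "\<dots> = amalgam_norm g p q (schrodinger t (gaussian a))"
      using amalgam_norm_schrodinger_gaussian[OF g p q a, of t]
      by (simp add: s_def K_def D_def c_def d_def mult_ac)
    also have "\<dots> \<le> ennreal C * ennreal (B * a powr (- f))"
      using elim by (intro order_trans[OF estimate] mult_left_mono B) auto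
    also have "\<dots> = ennreal (C * (B * a powr (- f)))"
      using C by (simp flip: ennreal_mult')
    finally have ineq: "L / 2 * (s powr (- e) * K) \<le> C * (B * a powr (- f))"
      using C B(1) by (subst (asm) ennreal_le_iff) auto
    have "(D a / a\<^sup>2) powr (e - d / 4) * a powr \<sigma> = (s powr (- e) * K) * a powr f"
    proof -
      have ratio: "(D a / a\<^sup>2) powr r = D a powr r * a powr (- (2 * r))" for r
        using D[of a] a by (simp add: powr_divide powr_minus_divide powr_powr flip: powr_numeral)
      have exponent: "a powr (- (2 * (e - d / 4))) * a powr \<sigma> = a powr (- e) * a powr f"
        unfolding powr_add[symmetric] by (simp add: e_def f_def \<sigma>_def algebra_simps)
      have "D a powr e * D a powr (- d / 4) = D a powr (e - d / 4)"
        by (simp flip: powr_add)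
      moreover have "s powr (- e) = a powr (- e) * D a powr e"
        using a D[of a] by (simp add: s_def powr_divide powr_minus_divide)
      ultimately have sK: "s powr (- e) * K = a powr (- e) * D a powr (e - d / 4)"
        unfolding K_def by (simp only: mult.assoc)
      show ?thesis
        unfolding ratio sK mult.assoc exponent by (rule mult.left_commute)
    qed
    also have "\<dots> = 2 / L * (L / 2 * (s powr (- e) * K)) * a powr f"
      using L(1) by simp
    also have "\<dots> \<le> 2 / L * (C * (B * a powr (- f))) * a powr f"
      using ineq L(1) by (intro mult_right_mono mult_left_mono) auto
    also have "\<dots> = 2 * C * B / L"
      using a by (simp add: powr_minus)
    finally show ?case .
  qed
  moreover have "eventually (\<lambda>a. (D a / a\<^sup>2) powr (e - d / 4) * a powr \<sigma> > 2 * C * B / L) at_top"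
  proof -
    have "filterlim (\<lambda>a. exp (\<sigma> * ln a)) at_top at_top"
      by (intro filterlim_compose[OF exp_at_top]
          filterlim_tendsto_pos_mult_at_top[OF tendsto_const \<sigma> ln_at_top])
    moreover have "eventually (\<lambda>a. exp (\<sigma> * ln a) = a powr \<sigma>) at_top"
      using eventually_gt_at_top[of 0] by eventually_elim (simp add: powr_def)
    ultimately have "filterlim (\<lambda>a. a powr \<sigma>) at_top at_top"
      by (rule filterlim_mono_eventually[OF _ order_refl order_refl])
    moreover have "((\<lambda>a. (D a / a\<^sup>2) powr (e - d / 4)) \<longlongrightarrow> (c\<^sup>2) powr (e - d / 4)) at_top"
      using quadratic_ratio_tendsto(1)[OF c] c unfolding D_def
      by (intro tendsto_powr tendsto_const) auto
    moreover have "(c\<^sup>2) powr (e - d / 4) > 0" using c by simp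
    ultimately have "filterlim (\<lambda>a. (D a / a\<^sup>2) powr (e - d / 4) * a powr \<sigma>) at_top at_top"
      by (intro filterlim_tendsto_pos_mult_at_top)
    then show ?thesis by (simp add: filterlim_at_top_dense)
  qed
  ultimately have "eventually (\<lambda>a::real. False) at_top"
    by eventually_elim simp
  then show False by simp
qed

theorem proposition5p3:
  fixes g :: "'a::euclidean_space \<Rightarrow> complex"
  assumes "amalgam_window g"
  shows "(\<forall>r1 r2 :: ennreal. 1 \<le> r1 \<and> 1 \<le> r2 \<longrightarrow>
            (\<exists>C::real. C > 0 \<and>
              ((\<lambda>t::real. amalgam_norm g r1 r2 (schrodinger t (gaussian 1))
                  / ennreal (C * t powr (real DIM('a) * (enn2real (1 / r2) - 1 / 2))))
                \<longlongrightarrow> 1) at_top))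
       \<and> (\<forall>(t0::real) (r1::ennreal) (r2::ennreal) (C::real).
            t0 \<noteq> 0 \<and> 1 \<le> r1 \<and> 1 \<le> r2 \<and> C > 0 \<and>
            (\<forall>u :: 'a \<Rightarrow> complex. schwartz_fun u \<longrightarrow>
               amalgam_norm g r1 r2 (schrodinger t0 u)
                 \<le> ennreal C * amalgam_norm g (conj_exponent r1) (conj_exponent r2) u)
            \<longrightarrow> r1 \<le> r2)"
proof (intro conjI allI impI)
  fix r1 r2 :: ennreal
  assume "1 \<le> r1 \<and> 1 \<le> r2"
  then show "\<exists>C::real. C > 0 \<and>
      ((\<lambda>t::real. amalgam_norm g r1 r2 (schrodinger t (gaussian 1))
          / ennreal (C * t powr (real DIM('a) * (enn2real (1 / r2) - 1 / 2))))
        \<longlongrightarrow> 1) at_top"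
    using amalgam_norm_schrodinger_gaussian_asymptotics[OF assms] by blast
next
  fix t0 :: real and r1 r2 :: ennreal and C :: real
  assume *: "t0 \<noteq> 0 \<and> 1 \<le> r1 \<and> 1 \<le> r2 \<and> C > 0 \<and>
            (\<forall>u :: 'a \<Rightarrow> complex. schwartz_fun u \<longrightarrow>
               amalgam_norm g r1 r2 (schrodinger t0 u)
                 \<le> ennreal C * amalgam_norm g (conj_exponent r1) (conj_exponent r2) u)"
  show "r1 \<le> r2"
  proof (rule amalgam_fixed_time_estimate_exponents[OF assms])
    fix a :: real assume "a \<ge> 1"
    then have "schwartz_fun (gaussian a :: 'a \<Rightarrow> complex)" by (intro schwartz_gaussian) simp
    then show "amalgam_norm g r1 r2 (schrodinger t0 (gaussian a))
      \<le> ennreal C * amalgam_norm g (conj_exponent r1) (conj_exponent r2) (gaussian a)"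
      using * by blast
  qed (use * in auto)
qed

end
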